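(* Let $m\ge 3$ be an integer, and put $n=\left\lceil\frac{1+\sqrt{8m}}{2}\right\rceil$ and $s=m-\binom{n-1}{2}$. Let $\mathbb{G}(m)$ be the set of connected simple graphs (of any order) with exactly $m$ edges, and let $G\in\mathbb{G}(m)$ be such that $\rho(G)$ is as small as possible, i.e., $\rho(G)\le\rho(G')$ for every $G'\in\mathbb{G}(m)$. Then $G$ has exactly $n$ vertices, and: (i) if $s\ge \frac{n-1}{2}$, then $\Delta(G)=n-1$; (ii) if $s=\frac{n-2}{2}$ and $n$ is even, then $\Delta(G)=\delta(G)=n-2$; (iii) if $1\le s<\frac{n-2}{2}$, then $\Delta(G)=n-2$ and $\delta(G)=n-3$, i.e., each component of the complement $\overline{G}$ is either a cycle or a nontrivial path, and exactly $s+1$ components of $\overline{G}$ are paths.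
   Context: All graphs are finite and simple. For a connected graph $G$, the distance matrix is $D(G)=(d_G(u,v))_{u,v\in V(G)}$, where $d_G(u,v)$ is the length of a shortest path between $u$ and $v$; the distance spectral radius $\rho(G)$ is the largest eigenvalue of $D(G)$. $\Delta(G)$ and $\delta(G)$ denote the maximum and minimum degree of $G$, and $\overline{G}$ its complement. A nontrivial path is a path with at least two vertices. The number $n$ is the unique positive integer with $\binom{n-1}{2}<m\le\binom{n}{2}$, so that $1\le s\le n-1$. *)

theory Defs
  imports
    "Graph_Theory.Graph_Theory"
    "Jordan_Normal_Form.Spectral_Radius"
begin

text \<open>
  A finite simple graph is a \<open>pair_graph\<close>: a finite loopless digraph with a symmetric arc
  relation. An edge \<open>{u, v}\<close> corresponds to the two arcs \<open>(u, v)\<close> and \<open>(v, u)\<close>, and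
  the degree of a vertex is its out-degree.
\<close>

definition graph_edges :: "'a pair_pre_digraph \<Rightarrow> 'a set set" where
  "graph_edges G = {{u, v} | u v. (u, v) \<in> parcs G}"

definition max_degree :: "'a pair_pre_digraph \<Rightarrow> nat" where
  "max_degree G = Max (out_degree (with_proj G) ` pverts G)"

definition min_degree :: "'a pair_pre_digraph \<Rightarrow> nat" where
  "min_degree G = Min (out_degree (with_proj G) ` pverts G)"

definition graph_complement :: "'a pair_pre_digraph \<Rightarrow> 'a pair_pre_digraph" where
  "graph_complement G =
     \<lparr> pverts = pverts G,
       parcs = {(u, v). u \<in> pverts G \<and> v \<in> pverts G \<and> u \<noteq> v \<and> (u, v) \<notin> parcs G} \<rparr>"

text \<open>The strongly connected components of a symmetric digraph are the connected components
  of the underlying undirected graph.\<close>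

definition graph_components :: "'a pair_pre_digraph \<Rightarrow> ('a, 'a \<times> 'a) pre_digraph set" where
  "graph_components G = pre_digraph.sccs (with_proj G)"

definition path_graph :: "nat \<Rightarrow> nat pair_pre_digraph" where
  "path_graph k =
     \<lparr> pverts = {0..<k},
       parcs = {(i, j). i < k \<and> j < k \<and> (j = Suc i \<or> i = Suc j)} \<rparr>"

definition cycle_graph :: "nat \<Rightarrow> nat pair_pre_digraph" where
  "cycle_graph k =
     \<lparr> pverts = {0..<k},
       parcs = {(i, j). i < k \<and> j < k \<and> (j = Suc i mod k \<or> i = Suc j mod k)} \<rparr>"

definition is_nontrivial_path :: "('a, 'b) pre_digraph \<Rightarrow> bool" where
  "is_nontrivial_path H \<longleftrightarrow> (\<exists>k\<ge>2. digraph_iso H (with_proj (path_graph k)))"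

definition is_cycle :: "('a, 'b) pre_digraph \<Rightarrow> bool" where
  "is_cycle H \<longleftrightarrow> (\<exists>k\<ge>3. digraph_iso H (with_proj (cycle_graph k)))"

text \<open>With all arcs of weight 1, \<open>\<mu>\<close> is the least length of a walk. It is finite between
  vertices of a connected graph, the only case in which it is used.\<close>

definition graph_dist :: "'a pair_pre_digraph \<Rightarrow> 'a \<Rightarrow> 'a \<Rightarrow> real" where
  "graph_dist G u v = real_of_ereal (wf_digraph.\<mu> (with_proj G) (\<lambda>_. 1) u v)"

text \<open>Library matrices are indexed by \<open>{0..<n}\<close>, so the vertices are listed in an arbitrary
  fixed order; the order does not affect the eigenvalues.\<close>

definition vertex_list :: "'a pair_pre_digraph \<Rightarrow> 'a list" where
  "vertex_list G = (SOME vs. distinct vs \<and> set vs = pverts G)"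

definition distance_matrix :: "'a pair_pre_digraph \<Rightarrow> real mat" where
  "distance_matrix G =
     mat (card (pverts G)) (card (pverts G))
       (\<lambda>(i, j). graph_dist G (vertex_list G ! i) (vertex_list G ! j))"

text \<open>The distance matrix is real symmetric, hence all its eigenvalues are real and form a
  finite set, nonempty as soon as the graph has a vertex.\<close>

definition distance_spectral_radius :: "'a pair_pre_digraph \<Rightarrow> real" where
  "distance_spectral_radius G = Max (spectrum (distance_matrix G))"

definition connected_graphs_with_edges :: "nat \<Rightarrow> 'a pair_pre_digraph set" where
  "connected_graphs_with_edges m =
     {G. pair_graph G \<and> Digraph_Component.connected (with_proj G) \<and> card (graph_edges G) = m}"

end

theory Submission
  imports
    Defs
    "HOL-Analysis.Function_Topology"
    "HOL-Analysis.Convex"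
begin

text \<open>
  Let \<open>H\<close> be the complement of a connected graph \<open>G\<close> with \<open>N\<close> vertices and \<open>m\<close> edges. Nonadjacent
  vertices are at distance at least 2, so the distance matrix of \<open>G\<close> dominates
  \<open>J - I + A(H)\<close> entrywise, with equality when nonadjacent vertices always have a common neighbour.
  Minimising \<open>\<rho>(G)\<close> thus becomes a question about the adjacency matrix of a sparse graph \<open>H\<close>. The
  radius is compared through the Rayleigh quotient, which for a symmetric matrix is bounded by the
  largest eigenvalue (\<open>rayleigh_le_distance_spectral_radius\<close>,
  \<open>distance_spectral_radius_le\<close>).

  \<^emph>\<open>The order.\<close> Fewer than \<open>n\<close> vertices cannot carry \<open>m\<close> edges. If \<open>N > n\<close>, the all-ones
  vector already gives \<open>\<rho>(G) > n + 1\<close>, whereas a graph of diameter at most two on \<open>n\<close> vertices whose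
  complement is contained in a path, hence has degrees at most 2, has radius at most \<open>n + 1\<close>.

  \<^emph>\<open>Many edges.\<close> If \<open>s \<ge> (n - 1) / 2\<close>, then \<open>H\<close> has \<open>n - 1 - s \<le> (n - 1) / 2\<close> edges,
  which cannot touch all \<open>n\<close> vertices. A vertex that they miss has degree \<open>n - 1\<close> in \<open>G\<close>.

  \<^emph>\<open>Few edges.\<close> Let \<open>s \<le> (n - 2) / 2\<close>, put \<open>b = n - 2 - 2 * s\<close>, so that the degrees \<open>d\<close> of
  \<open>H\<close> satisfy \<open>\<Sum>(d - 1) = b\<close>, and let \<open>r \<ge> n\<close> solve \<open>(r - 1) * (r - n) = b\<close>. This \<open>r\<close> is the largest
  eigenvalue of \<open>J - I + diag(d)\<close> whenever all \<open>d\<close> lie in \<open>{1, 2}\<close>. Since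
  \<open>2 * x\<^sub>u * x\<^sub>v \<le> x\<^sub>u\<^sup>2 + x\<^sub>v\<^sup>2\<close>, the quadratic form of \<open>A(H)\<close> is at most that of \<open>diag(d)\<close>. So a
  graph of diameter at most two whose complement has all degrees in \<open>{1, 2}\<close> has \<open>\<rho> \<le> r\<close>
  (\<open>diameter_two_form_le\<close>), and such a graph exists: delete \<open>s\<close> pairwise disjoint
  edges from the path on \<open>n\<close> vertices so that no vertex becomes isolated, and take the complement.
  Conversely, extend the eigenvector for \<open>r\<close> linearly in the degree, that is, take
  \<open>x = 1 + (d - 1) / (r - 1)\<close>. Endpoints of an edge of \<open>H\<close> have degree at least 1, so there
  \<open>(d\<^sub>u - 1) * (d\<^sub>v - 1) \<ge> 0\<close>, and this crude bound gives
  \<open>x\<^sup>T (J - I + A(H)) x - r * x\<^sup>T x \<ge> ((r - 3) * f - 2 * b) / (r - 1)\<^sup>2\<close> with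
  \<open>f = \<Sum>(d - 1) * (d - 2)\<close> (\<open>degree_test_vector_form_ge\<close>). Each term of \<open>f\<close> is 0 for a degree in
  \<open>{1, 2}\<close> and at least 2 otherwise; as \<open>b \<le> n - 4\<close>, a single degree outside \<open>{1, 2}\<close> makes the
  right-hand side positive and forces \<open>\<rho>(G) > r\<close>. Hence all degrees of the complement of an
  extremal graph lie in \<open>{1, 2}\<close> (\<open>extremal_order_and_complement_degrees\<close>).

  A finite graph with all degrees in \<open>{1, 2}\<close> is a disjoint union of cycles and
  nontrivial paths (\<open>component_cycle_or_path\<close>), and the paths are counted by the difference of the
  numbers of vertices and edges, here \<open>n - (n - 1 - s) = s + 1\<close>.
\<close>

section \<open>Rayleigh quotients of symmetric forms\<close>

lemma linear_coeff_zero_if_quadratic_nonneg: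
  fixes c d :: real
  assumes "\<And>t. 0 \<le> 2 * t * c + t\<^sup>2 * d"
  shows "c = 0"
proof (rule ccontr)
  assume c: "c \<noteq> 0"
  define M where "M = \<bar>d\<bar> + 1"
  have M: "M > 0" "d < M" by (auto simp: M_def)
  \<comment> \<open>The step opposite to \<open>c\<close>, short enough that the quadratic term cannot compensate.\<close>
  have "0 \<le> 2 * (- c / M) * c + (- c / M)\<^sup>2 * d" by (rule assms)
  also have "\<dots> = (c\<^sup>2 / M) * (d / M - 2)"
    using M by (simp add: field_simps power2_eq_square)
  also have "\<dots> < 0"
  proof (rule mult_pos_neg)
    show "0 < c\<^sup>2 / M" using c M by simp
    have "d / M < 1" using M by simp
    then show "d / M - 2 < 0" by simp
  qed
  finally show False by simp
qed

text \<open>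
  The form attains its maximum on the unit sphere, which is compact as a closed subset of a product
  of intervals; coordinates outside \<open>I\<close> are pinned to 0 so that the product is compact. At a
  maximiser \<open>z\<close> the first variation vanishes, which is the eigenvalue equation.
\<close>

lemma symmetric_form_max_eigenpair:
  fixes K :: "'i \<Rightarrow> 'i \<Rightarrow> real"
  assumes fin: "finite I" and ne: "I \<noteq> {}"
    and sym: "\<And>i j. i \<in> I \<Longrightarrow> j \<in> I \<Longrightarrow> K i j = K j i"
  shows "\<exists>\<mu> z. (\<forall>i\<in>I. (\<Sum>j\<in>I. K i j * z j) = \<mu> * z i) \<and> (\<exists>i\<in>I. z i \<noteq> 0) \<and>
    (\<forall>x. (\<Sum>i\<in>I. \<Sum>j\<in>I. K i j * x i * x j) \<le> \<mu> * (\<Sum>i\<in>I. (x i)\<^sup>2))"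
proof -
  define B where "B x y = (\<Sum>i\<in>I. \<Sum>j\<in>I. K i j * x i * y j)" for x y
  define N where "N x = (\<Sum>i\<in>I. (x i)\<^sup>2)" for x :: "'i \<Rightarrow> real"
  define S where "S = PiE UNIV (\<lambda>i. if i \<in> I then {-1..1} else {0::real}) \<inter> {x. N x = 1}"
  have cont_N: "continuous_on T N" for T
    unfolding N_def by (intro continuous_intros continuous_on_product_then_coordinatewise)
  have cont_B: "continuous_on T (\<lambda>x. B x x)" for T
    unfolding B_def by (intro continuous_intros continuous_on_product_then_coordinatewise)
  have "compactin (product_topology (\<lambda>i. euclidean) UNIV)
          (PiE UNIV (\<lambda>i. if i \<in> I then {-1..1} else {0::real}))"
    by (subst compactin_PiE) auto
  then have "compact (PiE UNIV (\<lambda>i. if i \<in> I then {-1..1} else {0::real}))"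
    by (simp add: euclidean_product_topology)
  moreover have "closed {x. N x = 1}"
    by (intro closed_Collect_eq cont_N continuous_on_const)
  ultimately have "compact S" unfolding S_def by (rule compact_Int_closed)
  have unit_in_S: "(\<lambda>i. if i \<in> I then x i / sqrt (N x) else 0) \<in> S" if "N x > 0" for x
  proof -
    have "\<bar>x i\<bar> \<le> sqrt (N x)" if "i \<in> I" for i
    proof -
      have "(x i)\<^sup>2 \<le> N x" unfolding N_def using that fin by (intro member_le_sum) auto
      then show ?thesis using real_sqrt_le_mono by fastforce
    qed
    then have "- 1 \<le> x i / sqrt (N x) \<and> x i / sqrt (N x) \<le> 1" if "i \<in> I" for i
      using that \<open>N x > 0\<close> by (force simp add: divide_le_eq le_divide_eq abs_le_iff minus_le_iff)
    moreover have "N (\<lambda>i. if i \<in> I then x i / sqrt (N x) else 0) = 1"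
    proof -
      have "N (\<lambda>i. if i \<in> I then x i / sqrt (N x) else 0) = (\<Sum>i\<in>I. (x i)\<^sup>2 / N x)"
        unfolding N_def[of "\<lambda>i. if i \<in> I then x i / sqrt (N x) else 0"]
        using \<open>N x > 0\<close> by (intro sum.cong) (auto simp: power_divide)
      also have "\<dots> = 1" using \<open>N x > 0\<close> by (simp add: sum_divide_distrib[symmetric] N_def[symmetric])
      finally show ?thesis .
    qed
    ultimately show ?thesis unfolding S_def by auto
  qed
  have "N (\<lambda>_. 1) > 0" using fin ne by (simp add: N_def card_gt_0_iff)
  then have "S \<noteq> {}" using unit_in_S by blast
  from continuous_attains_sup[OF \<open>compact S\<close> this cont_B]
  obtain z where z: "z \<in> S" and z_max: "\<And>y. y \<in> S \<Longrightarrow> B y y \<le> B z z" by blast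
  define \<mu> where "\<mu> = B z z"
  have Nz: "N z = 1" using z by (simp add: S_def)
  have rayleigh: "B x x \<le> \<mu> * N x" for x
  proof (cases "N x > 0")
    case True
    let ?y = "\<lambda>i. if i \<in> I then x i / sqrt (N x) else 0"
    have "B ?y ?y = (\<Sum>i\<in>I. \<Sum>j\<in>I. K i j * x i * x j / N x)"
      unfolding B_def using True by (intro sum.cong refl) (auto simp: field_simps)
    also have "\<dots> = B x x / N x" by (simp add: B_def sum_divide_distrib)
    finally have "B x x / N x \<le> \<mu>" using z_max[OF unit_in_S[OF True]] by (simp add: \<mu>_def)
    then show ?thesis using True by (simp add: divide_le_eq)
  next
    case False
    moreover have "N x \<ge> 0" unfolding N_def by (intro sum_nonneg) auto
    ultimately have "N x = 0" by simp
    then have "\<forall>i\<in>I. x i = 0" using fin by (simp add: N_def sum_nonneg_eq_0_iff)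
    then show ?thesis using \<open>N x = 0\<close> by (simp add: B_def)
  qed
  \<comment> \<open>Perturbing \<open>z\<close> along its own residual makes the first variation equal to the squared norm of the residual.\<close>
  define r where "r i = \<mu> * z i - (\<Sum>j\<in>I. K i j * z j)" for i
  have B_sym: "B x y = B y x" for x y
    unfolding B_def by (subst sum.swap) (auto intro!: sum.cong simp: sym)
  have expand_B: "B (\<lambda>i. z i + t * r i) (\<lambda>i. z i + t * r i) = B z z + 2 * t * B r z + t\<^sup>2 * B r r" for t
  proof -
    have "B (\<lambda>i. z i + t * r i) (\<lambda>i. z i + t * r i) = B z z + t * B z r + t * B r z + t\<^sup>2 * B r r"
      by (simp add: B_def algebra_simps sum.distrib sum_distrib_left power2_eq_square)
    then show ?thesis using B_sym[of z r] by (simp add: algebra_simps)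
  qed
  have expand_N: "N (\<lambda>i. z i + t * r i) = N z + 2 * t * (\<Sum>i\<in>I. z i * r i) + t\<^sup>2 * N r" for t
    by (simp add: N_def algebra_simps sum.distrib sum_distrib_left power2_eq_square)
  have "N r = \<mu> * (\<Sum>i\<in>I. z i * r i) - B r z"
  proof -
    have "N r = (\<Sum>i\<in>I. \<mu> * (z i * r i) - (\<Sum>j\<in>I. K i j * r i * z j))"
      unfolding N_def
    proof (intro sum.cong refl)
      fix i assume "i \<in> I"
      have "(r i)\<^sup>2 = r i * (\<mu> * z i - (\<Sum>j\<in>I. K i j * z j))"
        by (simp add: power2_eq_square r_def)
      also have "\<dots> = \<mu> * (z i * r i) - (\<Sum>j\<in>I. K i j * r i * z j)"
        by (simp add: algebra_simps sum_distrib_left)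
      finally show "(r i)\<^sup>2 = \<mu> * (z i * r i) - (\<Sum>j\<in>I. K i j * r i * z j)" .
    qed
    then show ?thesis by (simp add: sum_subtractf sum_distrib_left B_def)
  qed
  moreover have "0 \<le> 2 * t * (\<mu> * (\<Sum>i\<in>I. z i * r i) - B r z) + t\<^sup>2 * (\<mu> * N r - B r r)" for t
    using rayleigh[of "\<lambda>i. z i + t * r i"] unfolding expand_B expand_N Nz \<mu>_def[symmetric]
    by (simp add: algebra_simps)
  ultimately have "N r = 0" using linear_coeff_zero_if_quadratic_nonneg by metis
  then have "\<forall>i\<in>I. r i = 0" using fin by (simp add: N_def sum_nonneg_eq_0_iff)
  then have "\<forall>i\<in>I. (\<Sum>j\<in>I. K i j * z j) = \<mu> * z i" by (simp add: r_def)
  moreover have "\<exists>i\<in>I. z i \<noteq> 0"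
  proof (rule ccontr)
    assume "\<not> ?thesis"
    then have "N z = 0" by (simp add: N_def)
    with Nz show False by simp
  qed
  moreover have "\<forall>x. (\<Sum>i\<in>I. \<Sum>j\<in>I. K i j * x i * x j) \<le> \<mu> * (\<Sum>i\<in>I. (x i)\<^sup>2)"
    using rayleigh by (simp add: B_def N_def)
  ultimately show ?thesis by blast
qed

section \<open>Distances and the distance spectral radius\<close>

lemma vertex_list_enumerates:
  assumes "finite (pverts G)"
  shows "bij_betw (\<lambda>i. vertex_list G ! i) {..<card (pverts G)} (pverts G)"
proof -
  have "\<exists>vs. distinct vs \<and> set vs = pverts G"
    using finite_distinct_list[OF assms] by blast
  then have "distinct (vertex_list G) \<and> set (vertex_list G) = pverts G"
    unfolding vertex_list_def by (rule someI_ex)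
  then show ?thesis using bij_betw_nth[of "vertex_list G"] distinct_card by metis
qed

text \<open>
  Eigenvectors of the distance matrix read as functions on the vertices, which removes the
  enumeration of the vertices from everything that follows.
\<close>

lemma eigenvalue_iff_eigenfunction:
  assumes fin: "finite (pverts G)"
  shows "k \<in> spectrum (distance_matrix G) \<longleftrightarrow>
    (\<exists>z. (\<exists>u\<in>pverts G. z u \<noteq> 0) \<and>
         (\<forall>u\<in>pverts G. (\<Sum>v\<in>pverts G. graph_dist G u v * z v) = k * z u))"
proof -
  define n where "n = card (pverts G)"
  define \<phi> where "\<phi> i = vertex_list G ! i" for i
  have bij: "bij_betw \<phi> {..<n} (pverts G)"
    unfolding \<phi>_def n_def by (rule vertex_list_enumerates[OF fin])
  have dim: "dim_row (distance_matrix G) = n" "dim_col (distance_matrix G) = n"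
    by (simp_all add: distance_matrix_def n_def)
  have mult: "(distance_matrix G *\<^sub>v w) $ i = (\<Sum>v\<in>pverts G. graph_dist G (\<phi> i) v * z v)"
    if "i < n" "dim_vec w = n" "\<And>j. j < n \<Longrightarrow> w $ j = z (\<phi> j)" for w z i
  proof -
    have "(distance_matrix G *\<^sub>v w) $ i = (\<Sum>j<n. graph_dist G (\<phi> i) (\<phi> j) * z (\<phi> j))"
      using that by (simp add: distance_matrix_def n_def[symmetric] \<phi>_def scalar_prod_def
          lessThan_atLeast0)
    also have "\<dots> = (\<Sum>v\<in>pverts G. graph_dist G (\<phi> i) v * z v)"
      by (rule sum.reindex_bij_betw[OF bij])
    finally show ?thesis .
  qed
  have V: "pverts G = \<phi> ` {..<n}" using bij by (simp add: bij_betw_def)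
  have all_verts: "(\<forall>u\<in>pverts G. P u) \<longleftrightarrow> (\<forall>i<n. P (\<phi> i))" for P
    unfolding V by auto
  have ex_verts: "(\<exists>u\<in>pverts G. P u) \<longleftrightarrow> (\<exists>i<n. P (\<phi> i))" for P
    unfolding V by auto
  show ?thesis
  proof
    assume "k \<in> spectrum (distance_matrix G)"
    then obtain w where w: "dim_vec w = n" "w \<noteq> 0\<^sub>v n" "distance_matrix G *\<^sub>v w = k \<cdot>\<^sub>v w"
      unfolding spectrum_def eigenvalue_def eigenvector_def dim by (auto dest!: carrier_vecD)
    define z where "z u = w $ (the_inv_into {..<n} \<phi> u)" for u
    have z: "z (\<phi> i) = w $ i" if "i < n" for i
      using that bij by (simp add: z_def the_inv_into_f_f bij_betw_def)
    have "\<exists>i<n. z (\<phi> i) \<noteq> 0"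
      using w(1,2) z by (auto simp: vec_eq_iff)
    moreover have "(\<Sum>v\<in>pverts G. graph_dist G (\<phi> i) v * z v) = k * z (\<phi> i)" if "i < n" for i
      using mult[OF that w(1), of z] z w(3) w(1) that by simp
    ultimately show "\<exists>z. (\<exists>u\<in>pverts G. z u \<noteq> 0) \<and>
         (\<forall>u\<in>pverts G. (\<Sum>v\<in>pverts G. graph_dist G u v * z v) = k * z u)"
      unfolding all_verts ex_verts by blast
  next
    assume "\<exists>z. (\<exists>u\<in>pverts G. z u \<noteq> 0) \<and>
         (\<forall>u\<in>pverts G. (\<Sum>v\<in>pverts G. graph_dist G u v * z v) = k * z u)"
    then obtain z where z: "\<exists>i<n. z (\<phi> i) \<noteq> 0"
      "\<And>i. i < n \<Longrightarrow> (\<Sum>v\<in>pverts G. graph_dist G (\<phi> i) v * z v) = k * z (\<phi> i)"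
      unfolding all_verts ex_verts by blast
    define w where "w = vec n (\<lambda>i. z (\<phi> i))"
    have "w \<noteq> 0\<^sub>v n"
    proof
      assume "w = 0\<^sub>v n"
      then have "\<forall>i<n. w $ i = 0" by simp
      with z(1) show False by (auto simp: w_def)
    qed
    moreover have "distance_matrix G *\<^sub>v w = k \<cdot>\<^sub>v w"
    proof (rule eq_vecI)
      fix i assume "i < dim_vec (k \<cdot>\<^sub>v w)"
      then have "i < n" by (simp add: w_def)
      then show "(distance_matrix G *\<^sub>v w) $ i = (k \<cdot>\<^sub>v w) $ i"
        using mult[of i w z] z(2) by (simp add: w_def)
    qed (simp add: dim w_def)
    moreover have "w \<in> carrier_vec n" by (simp add: w_def)
    ultimately show "k \<in> spectrum (distance_matrix G)"
      unfolding spectrum_def eigenvalue_def eigenvector_def dim mem_Collect_eq by blast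
  qed
qed

lemma connected_pverts_nonempty:
  "Digraph_Component.connected (with_proj G) \<Longrightarrow> pverts G \<noteq> {}"
  by (auto simp: connected_conv)

text \<open>
  Walk lengths are natural numbers and connectedness provides a walk, so the infimum that defines the
  distance is finite and attained.
\<close>

lemma (in pair_graph) geodesic:
  assumes conn: "Digraph_Component.connected (with_proj G)" and "u \<in> pverts G" "v \<in> pverts G"
  shows "\<exists>p. awalk u p v \<and> graph_dist G u v = real (length p)"
    and "awalk u q v \<Longrightarrow> graph_dist G u v \<le> real (length q)"
proof -
  have cost: "awalk_cost (\<lambda>_. 1) p = real (length p)" for p
    by (induct p) auto
  have "strongly_connected (with_proj G)"
    using symmetric_connected_imp_strongly_connected sym_arcs conn by blast
  then have "u \<rightarrow>\<^sup>*\<^bsub>with_proj G\<^esub> v" using assms by (auto simp: strongly_connected_def)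
  then obtain p0 where p0: "awalk u p0 v" by (metis reachable_awalk)
  define k where "k = (LEAST k. \<exists>p. awalk u p v \<and> length p = k)"
  have "\<exists>p. awalk u p v \<and> length p = k"
    unfolding k_def by (rule LeastI_ex) (use p0 in blast)
  then obtain p where p: "awalk u p v" "length p = k" by blast
  have least: "k \<le> length q" if "awalk u q v" for q
    unfolding k_def using that by (intro Least_le) blast
  have "\<mu> (\<lambda>_. 1) u v = ereal (real k)"
  proof (rule antisym)
    show "\<mu> (\<lambda>_. 1) u v \<le> ereal (real k)"
      using min_cost_le_walk_cost[OF p(1), of "\<lambda>_. 1"] p(2) by (simp add: cost)
    show "ereal (real k) \<le> \<mu> (\<lambda>_. 1) u v"
      unfolding \<mu>_def by (rule INF_greatest) (use least in \<open>auto simp: cost\<close>)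
  qed
  then have dist: "graph_dist G u v = real k" by (simp add: graph_dist_def)
  show "\<exists>p. awalk u p v \<and> graph_dist G u v = real (length p)" using p dist by auto
  show "awalk u q v \<Longrightarrow> graph_dist G u v \<le> real (length q)" using least dist by simp
qed

lemma (in pair_graph) graph_dist_commute:
  assumes "Digraph_Component.connected (with_proj G)" "u \<in> pverts G" "v \<in> pverts G"
  shows "graph_dist G u v = graph_dist G v u"
proof -
  have le: "graph_dist G a b \<le> graph_dist G b a" if ab: "a \<in> pverts G" "b \<in> pverts G" for a b
  proof -
    obtain p where p: "awalk b p a" "graph_dist G b a = real (length p)"
      using geodesic(1)[OF assms(1)] ab by blast
    have "length (rev_path p) = length p" by (induct p) auto
    then show ?thesis using geodesic(2)[OF assms(1) ab, of "rev_path p"] p by simp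
  qed
  show ?thesis using le assms by (intro antisym) auto
qed

lemma (in pair_graph) graph_dist_self:
  assumes "Digraph_Component.connected (with_proj G)" "u \<in> pverts G"
  shows "graph_dist G u u = 0"
proof -
  have "awalk u [] u" using assms by (simp add: awalk_Nil_iff)
  from geodesic(2)[OF assms assms(2) this] geodesic(1)[OF assms assms(2)]
  show ?thesis by auto
qed

text \<open>
  A walk between distinct vertices has positive length, and a walk of length 1 is an arc.
\<close>

lemma (in pair_graph) graph_dist_lower:
  assumes conn: "Digraph_Component.connected (with_proj G)"
    and uv: "u \<in> pverts G" "v \<in> pverts G" "u \<noteq> v"
  shows "1 + of_bool ((u, v) \<in> parcs (graph_complement G)) \<le> graph_dist G u v"
proof -
  obtain p where p: "awalk u p v" "graph_dist G u v = real (length p)"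
    using geodesic(1)[OF conn uv(1,2)] by blast
  have "p \<noteq> []" using p uv by (auto simp: awalk_Nil_iff)
  moreover have "(u, v) \<in> parcs G" if "length p = 1"
    using that p(1) by (auto simp: length_Suc_conv awalk_simps)
  ultimately have "1 + of_bool ((u, v) \<in> parcs (graph_complement G)) \<le> length p"
    by (cases "length p") (auto simp: graph_complement_def Suc_le_eq)
  then have "real (1 + of_bool ((u, v) \<in> parcs (graph_complement G))) \<le> graph_dist G u v"
    unfolding p(2) by (simp only: of_nat_le_iff)
  then show ?thesis by simp
qed

lemma (in pair_graph) graph_dist_diameter_two:
  assumes conn: "Digraph_Component.connected (with_proj G)"
    and diam: "\<And>a b. (a, b) \<in> parcs (graph_complement G) \<Longrightarrow>
      \<exists>w. (a, w) \<in> parcs G \<and> (w, b) \<in> parcs G"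
    and uv: "u \<in> pverts G" "v \<in> pverts G" "u \<noteq> v"
  shows "graph_dist G u v = 1 + of_bool ((u, v) \<in> parcs (graph_complement G))"
proof (rule antisym[OF _ graph_dist_lower[OF conn uv]])
  show "graph_dist G u v \<le> 1 + of_bool ((u, v) \<in> parcs (graph_complement G))"
  proof (cases "(u, v) \<in> parcs (graph_complement G)")
    case True
    then obtain w where "(u, w) \<in> parcs G" "(w, v) \<in> parcs G" using diam by blast
    then have "awalk u [(u, w), (w, v)] v" using uv by (simp add: awalk_simps)
    from geodesic(2)[OF conn uv(1,2) this] True show ?thesis by simp
  next
    case False
    then have "awalk u [(u, v)] v" using uv by (simp add: awalk_simps graph_complement_def)
    from geodesic(2)[OF conn uv(1,2) this] False show ?thesis by simp
  qed
qed

lemma rayleigh_le_distance_spectral_radius: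
  assumes "pair_graph G" and conn: "Digraph_Component.connected (with_proj G)"
  shows "(\<Sum>u\<in>pverts G. \<Sum>v\<in>pverts G. graph_dist G u v * x u * x v)
    \<le> distance_spectral_radius G * (\<Sum>u\<in>pverts G. (x u)\<^sup>2)"
proof -
  interpret pair_graph G by fact
  have fin: "finite (pverts G)" by simp
  have sym: "\<And>u v. u \<in> pverts G \<Longrightarrow> v \<in> pverts G \<Longrightarrow> graph_dist G u v = graph_dist G v u"
    by (rule graph_dist_commute[OF conn])
  obtain \<mu> z where eig: "\<forall>u\<in>pverts G. (\<Sum>v\<in>pverts G. graph_dist G u v * z v) = \<mu> * z u"
    and nz: "\<exists>u\<in>pverts G. z u \<noteq> 0"
    and form_le: "\<forall>x. (\<Sum>u\<in>pverts G. \<Sum>v\<in>pverts G. graph_dist G u v * x u * x v)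
      \<le> \<mu> * (\<Sum>u\<in>pverts G. (x u)\<^sup>2)"
    using symmetric_form_max_eigenpair[OF fin connected_pverts_nonempty[OF conn], where K = "graph_dist G", OF sym] by blast
  have "\<mu> \<in> spectrum (distance_matrix G)"
    using eig nz by (auto simp: eigenvalue_iff_eigenfunction[OF fin])
  moreover have "finite (spectrum (distance_matrix G))"
    by (rule card_finite_spectrum(1)[of _ "card (pverts G)"]) (simp add: distance_matrix_def)
  ultimately have "\<mu> \<le> distance_spectral_radius G"
    unfolding distance_spectral_radius_def by (rule Max_ge[rotated])
  then have "\<mu> * (\<Sum>u\<in>pverts G. (x u)\<^sup>2) \<le> distance_spectral_radius G * (\<Sum>u\<in>pverts G. (x u)\<^sup>2)"
    by (intro mult_right_mono sum_nonneg) auto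
  with form_le[rule_format, of x] show ?thesis by linarith
qed

lemma distance_spectral_radius_le:
  assumes "pair_graph G" and conn: "Digraph_Component.connected (with_proj G)"
    and form_le: "\<And>x. (\<Sum>u\<in>pverts G. \<Sum>v\<in>pverts G. graph_dist G u v * x u * x v)
      \<le> c * (\<Sum>u\<in>pverts G. (x u)\<^sup>2)"
  shows "distance_spectral_radius G \<le> c"
proof -
  interpret pair_graph G by fact
  have fin: "finite (pverts G)" by simp
  have sym: "\<And>u v. u \<in> pverts G \<Longrightarrow> v \<in> pverts G \<Longrightarrow> graph_dist G u v = graph_dist G v u"
    by (rule graph_dist_commute[OF conn])
  obtain \<mu> z where "\<forall>u\<in>pverts G. (\<Sum>v\<in>pverts G. graph_dist G u v * z v) = \<mu> * z u"
    and "\<exists>u\<in>pverts G. z u \<noteq> 0"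
    using symmetric_form_max_eigenpair[OF fin connected_pverts_nonempty[OF conn], where K = "graph_dist G", OF sym] by blast
  then have "\<mu> \<in> spectrum (distance_matrix G)"
    by (auto simp: eigenvalue_iff_eigenfunction[OF fin])
  then have ne: "spectrum (distance_matrix G) \<noteq> {}" by blast
  have "finite (spectrum (distance_matrix G))"
    by (rule card_finite_spectrum(1)[of _ "card (pverts G)"]) (simp add: distance_matrix_def)
  with ne have "distance_spectral_radius G \<in> spectrum (distance_matrix G)"
    unfolding distance_spectral_radius_def by (rule Max_in[rotated])
  then obtain z where nz: "\<exists>u\<in>pverts G. z u \<noteq> 0" and
    eig: "\<And>u. u \<in> pverts G \<Longrightarrow>
      (\<Sum>v\<in>pverts G. graph_dist G u v * z v) = distance_spectral_radius G * z u"
    by (auto simp: eigenvalue_iff_eigenfunction[OF fin])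
  have "(\<Sum>u\<in>pverts G. \<Sum>v\<in>pverts G. graph_dist G u v * z u * z v)
      = (\<Sum>u\<in>pverts G. z u * (\<Sum>v\<in>pverts G. graph_dist G u v * z v))"
    by (simp add: sum_distrib_left mult_ac)
  also have "\<dots> = distance_spectral_radius G * (\<Sum>u\<in>pverts G. (z u)\<^sup>2)"
    by (simp add: eig sum_distrib_left[symmetric] power2_eq_square mult.left_commute)
  finally have "distance_spectral_radius G * (\<Sum>u\<in>pverts G. (z u)\<^sup>2)
      \<le> c * (\<Sum>u\<in>pverts G. (z u)\<^sup>2)"
    using form_le[of z] by simp
  moreover have "0 < (\<Sum>u\<in>pverts G. (z u)\<^sup>2)"
    using nz fin by (auto intro!: sum_pos2)
  ultimately show ?thesis by simp
qed

section \<open>The form \<open>J - I + A\<close>\<close>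

lemma sum_over_arcs_tail:
  fixes f :: "'v \<Rightarrow> real"
  assumes "finite V" "E \<subseteq> V \<times> V"
  shows "(\<Sum>(u, v)\<in>E. f u) = (\<Sum>u\<in>V. card (E `` {u}) * f u)"
proof -
  have fin: "finite (E `` {u})" for u
    by (rule finite_subset[OF _ assms(1)]) (use assms(2) in auto)
  have "E = Sigma V (\<lambda>u. E `` {u})" using assms(2) by auto
  then have "(\<Sum>(u, v)\<in>E. f u) = (\<Sum>(u, v)\<in>Sigma V (\<lambda>u. E `` {u}). f u)" by simp
  also have "\<dots> = (\<Sum>u\<in>V. \<Sum>v\<in>E `` {u}. f u)"
    using assms(1) fin by (subst sum.Sigma) auto
  finally show ?thesis by simp
qed

lemma sum_over_arcs_head:
  fixes f :: "'v \<Rightarrow> real"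
  assumes "finite V" "E \<subseteq> V \<times> V" "sym E"
  shows "(\<Sum>(u, v)\<in>E. f v) = (\<Sum>u\<in>V. card (E `` {u}) * f u)"
proof -
  have "(\<Sum>(u, v)\<in>E. f v) = (\<Sum>(u, v)\<in>E. f u)"
    using \<open>sym E\<close>
    by (intro sum.reindex_bij_witness[where i = prod.swap and j = prod.swap])
       (auto dest: symD)
  then show ?thesis using sum_over_arcs_tail[OF assms(1,2)] by simp
qed

lemma card_arcs_eq_sum_degrees:
  assumes "finite V" "E \<subseteq> V \<times> V"
  shows "real (card E) = (\<Sum>u\<in>V. real (card (E `` {u})))"
  using sum_over_arcs_tail[OF assms, of "\<lambda>_. 1"] by (simp add: case_prod_beta)

text \<open>
  The left-hand side is the quadratic form of \<open>J - I + A\<close>, where \<open>A\<close> is the adjacency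
  matrix of \<open>E\<close>.
\<close>

lemma diameter_two_form_eq:
  fixes x :: "'v \<Rightarrow> real"
  assumes "finite V" "E \<subseteq> V \<times> V"
  shows "(\<Sum>u\<in>V. \<Sum>v\<in>V. (of_bool (u \<noteq> v) + of_bool ((u, v) \<in> E)) * x u * x v)
    = (\<Sum>u\<in>V. x u)\<^sup>2 - (\<Sum>u\<in>V. (x u)\<^sup>2) + (\<Sum>(u, v)\<in>E. x u * x v)"
proof -
  have "(\<Sum>(u, v)\<in>E. x u * x v) = (\<Sum>a\<in>V \<times> V. of_bool (a \<in> E) * (x (fst a) * x (snd a)))"
  proof -
    have "(\<Sum>(u, v)\<in>E. x u * x v) = (\<Sum>a\<in>E. of_bool (a \<in> E) * (x (fst a) * x (snd a)))"
      by (intro sum.cong) auto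
    also have "\<dots> = (\<Sum>a\<in>V \<times> V. of_bool (a \<in> E) * (x (fst a) * x (snd a)))"
      using assms by (intro sum.mono_neutral_left) auto
    finally show ?thesis .
  qed
  also have "\<dots> = (\<Sum>u\<in>V. \<Sum>v\<in>V. of_bool ((u, v) \<in> E) * (x u * x v))"
    by (simp add: sum.cartesian_product case_prod_beta)
  finally have arcs: "(\<Sum>u\<in>V. \<Sum>v\<in>V. of_bool ((u, v) \<in> E) * (x u * x v)) = (\<Sum>(u, v)\<in>E. x u * x v)"
    by simp
  have "(\<Sum>u\<in>V. \<Sum>v\<in>V. of_bool (u \<noteq> v) * (x u * x v))
      = (\<Sum>u\<in>V. (\<Sum>v\<in>V. x u * x v) - x u * x u)"
  proof (intro sum.cong refl)
    fix u assume "u \<in> V"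
    have "(\<Sum>v\<in>V. of_bool (u \<noteq> v) * (x u * x v)) = (\<Sum>v\<in>V - {u}. x u * x v)"
      using assms(1) by (intro sum.mono_neutral_cong_right) auto
    also have "\<dots> = (\<Sum>v\<in>V. x u * x v) - x u * x u"
      using assms(1) \<open>u \<in> V\<close> by (simp add: sum_diff1)
    finally show "(\<Sum>v\<in>V. of_bool (u \<noteq> v) * (x u * x v)) = (\<Sum>v\<in>V. x u * x v) - x u * x u" .
  qed
  also have "\<dots> = (\<Sum>u\<in>V. x u)\<^sup>2 - (\<Sum>u\<in>V. (x u)\<^sup>2)"
    by (simp add: sum_subtractf power2_eq_square sum_product)
  finally show ?thesis using arcs by (simp add: algebra_simps sum.distrib)
qed

text \<open>
  By \<open>2 * x\<^sub>u * x\<^sub>v \<le> x\<^sub>u\<^sup>2 + x\<^sub>v\<^sup>2\<close> the adjacency matrix may be replaced by the diagonal matrix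
  of the degrees \<open>d\<close>. The claim then reads \<open>(\<Sum>x)\<^sup>2 \<le> \<Sum>(c + 1 - d) * x\<^sup>2\<close>, which is the
  Cauchy-Schwarz inequality with weights \<open>c + 1 - d\<close>. The hypothesis on the weights says that \<open>c\<close> is
  at least the largest eigenvalue of \<open>J - I + diag(d)\<close>.
\<close>

lemma diameter_two_form_le:
  fixes x :: "'v \<Rightarrow> real"
  assumes fin: "finite V" and E: "E \<subseteq> V \<times> V" "sym E"
    and pos: "\<And>v. v \<in> V \<Longrightarrow> real (card (E `` {v})) < c + 1"
    and weights: "(\<Sum>v\<in>V. 1 / (c + 1 - card (E `` {v}))) \<le> 1"
  shows "(\<Sum>u\<in>V. \<Sum>v\<in>V. (of_bool (u \<noteq> v) + of_bool ((u, v) \<in> E)) * x u * x v)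
    \<le> c * (\<Sum>u\<in>V. (x u)\<^sup>2)"
proof -
  define d where "d v = real (card (E `` {v}))" for v
  define w where "w v = c + 1 - d v" for v
  have w: "w v > 0" if "v \<in> V" for v using pos[OF that] by (simp add: w_def d_def)
  have "2 * (\<Sum>(u, v)\<in>E. x u * x v) \<le> (\<Sum>(u, v)\<in>E. (x u)\<^sup>2 + (x v)\<^sup>2)"
    unfolding sum_distrib_left by (intro sum_mono) (auto simp: sum_squares_bound mult.assoc[symmetric])
  also have "\<dots> = 2 * (\<Sum>v\<in>V. d v * (x v)\<^sup>2)"
    using sum_over_arcs_tail[OF fin E(1), of "\<lambda>v. (x v)\<^sup>2"]
      sum_over_arcs_head[OF fin E, of "\<lambda>v. (x v)\<^sup>2"]
    by (simp add: case_prod_beta sum.distrib d_def)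
  finally have arcs: "(\<Sum>(u, v)\<in>E. x u * x v) \<le> (\<Sum>v\<in>V. d v * (x v)\<^sup>2)" by simp
  have "(\<Sum>v\<in>V. x v)\<^sup>2 = (\<Sum>v\<in>V. (sqrt (w v) * x v) * (1 / sqrt (w v)))\<^sup>2"
    by (intro arg_cong[where f = "\<lambda>s. s\<^sup>2"] sum.cong) (auto dest!: w)
  also have "\<dots> \<le> (\<Sum>v\<in>V. (sqrt (w v) * x v)\<^sup>2) * (\<Sum>v\<in>V. (1 / sqrt (w v))\<^sup>2)"
    by (rule Cauchy_Schwarz_ineq_sum)
  also have "\<dots> = (\<Sum>v\<in>V. w v * (x v)\<^sup>2) * (\<Sum>v\<in>V. 1 / w v)"
    using w by (intro arg_cong2[where f = "(*)"] sum.cong)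
      (auto simp: power_mult_distrib power_divide less_imp_le)
  also have "\<dots> \<le> (\<Sum>v\<in>V. w v * (x v)\<^sup>2) * 1"
    using weights w by (intro mult_left_mono sum_nonneg) (auto simp: w_def d_def less_imp_le)
  finally have "(\<Sum>v\<in>V. x v)\<^sup>2 \<le> (\<Sum>v\<in>V. w v * (x v)\<^sup>2)" by simp
  also have "\<dots> = (c + 1) * (\<Sum>v\<in>V. (x v)\<^sup>2) - (\<Sum>v\<in>V. d v * (x v)\<^sup>2)"
    by (simp add: w_def left_diff_distrib sum_subtractf sum_distrib_left)
  finally show ?thesis
    unfolding diameter_two_form_eq[OF fin E(1)] using arcs by (simp add: algebra_simps)
qed

text \<open>
  If all degrees lie in \<open>{1, 2}\<close>, the equation for \<open>r\<close> says that \<open>r\<close> is an eigenvalue of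
  \<open>J - I + diag(d)\<close>, with eigenvector \<open>1\<close> at degree 1 and \<open>r / (r - 1)\<close> at degree 2. The test vector \<open>x\<close>
  interpolates these values linearly in the degree, so its entries always sum to \<open>r\<close>, and the sums
  below depend on the degrees only through \<open>\<Sum>(d - 1)\<close> and \<open>\<Sum>(d - 1) * (d - 2)\<close>. The arcs enter
  through \<open>x\<^sub>u * x\<^sub>v \<ge> 1 + t * (d\<^sub>u - 1) + t * (d\<^sub>v - 1)\<close>, valid because both endpoints of an arc have degree
  at least 1.
\<close>

lemma degree_test_vector_form_ge:
  fixes V :: "'v set" and E :: "('v \<times> 'v) set" and r :: real
  defines "d \<equiv> \<lambda>v. real (card (E `` {v}))"
  defines "x \<equiv> \<lambda>v. 1 + (d v - 1) / (r - 1)"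
  assumes fin: "finite V" and E: "E \<subseteq> V \<times> V" "sym E"
    and r: "r > 1" and b: "real (card E) - card V = (r - 1) * (r - card V)"
  shows "r * (\<Sum>v\<in>V. (x v)\<^sup>2)
      + ((r - 3) * (\<Sum>v\<in>V. (d v - 1) * (d v - 2)) - 2 * (real (card E) - card V)) / (r - 1)\<^sup>2
    \<le> (\<Sum>u\<in>V. \<Sum>v\<in>V. (of_bool (u \<noteq> v) + of_bool ((u, v) \<in> E)) * x u * x v)"
proof -
  define n where "n = real (card V)"
  define t where "t = 1 / (r - 1)"
  define f where "f = (\<Sum>v\<in>V. (d v - 1) * (d v - 2))"
  have x: "x v = 1 + t * (d v - 1)" for v by (simp add: x_def t_def)
  have t: "t \<ge> 0" "t * (r - 1) = 1" using r by (auto simp: t_def)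
  have card_E: "real (card E) = n + (r - 1) * (r - n)" using b by (simp add: n_def)
  have tb: "t * ((r - 1) * (r - n)) = r - n" using t by (simp add: mult.assoc[symmetric])
  have excess: "(\<Sum>v\<in>V. d v - 1) = (r - 1) * (r - n)"
    using card_arcs_eq_sum_degrees[OF fin E(1)] card_E
    by (simp add: sum_subtractf d_def n_def)
  have excess_sq: "(\<Sum>v\<in>V. (d v - 1)\<^sup>2) = f + (r - 1) * (r - n)"
  proof -
    have "(\<Sum>v\<in>V. (d v - 1)\<^sup>2) = (\<Sum>v\<in>V. (d v - 1) * (d v - 2) + (d v - 1))"
      by (intro sum.cong) (auto simp: power2_eq_square algebra_simps)
    then show ?thesis using excess by (simp add: sum.distrib f_def)
  qed
  have degree_excess: "(\<Sum>v\<in>V. d v * (d v - 1)) = f + 2 * ((r - 1) * (r - n))"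
  proof -
    have "(\<Sum>v\<in>V. d v * (d v - 1)) = (\<Sum>v\<in>V. (d v - 1) * (d v - 2) + 2 * (d v - 1))"
      by (intro sum.cong) (auto simp: algebra_simps)
    also have "\<dots> = f + 2 * (\<Sum>v\<in>V. d v - 1)"
      by (simp only: sum.distrib f_def sum_distrib_left)
    finally show ?thesis using excess by simp
  qed
  have sum_x: "(\<Sum>v\<in>V. x v) = r"
  proof -
    have "(\<Sum>v\<in>V. x v) = n + t * (\<Sum>v\<in>V. d v - 1)"
      by (simp add: x sum.distrib n_def sum_distrib_left[symmetric])
    also have "\<dots> = r" unfolding excess tb by simp
    finally show ?thesis .
  qed
  have sum_sq_x: "(\<Sum>v\<in>V. (x v)\<^sup>2) = n + 2 * (r - n) + t\<^sup>2 * (f + (r - 1) * (r - n))"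
  proof -
    have "(\<Sum>v\<in>V. (x v)\<^sup>2) = (\<Sum>v\<in>V. 1 + 2 * t * (d v - 1) + t\<^sup>2 * (d v - 1)\<^sup>2)"
      by (intro sum.cong) (auto simp: x power2_eq_square algebra_simps)
    also have "\<dots> = n + 2 * (t * (\<Sum>v\<in>V. d v - 1)) + t\<^sup>2 * (\<Sum>v\<in>V. (d v - 1)\<^sup>2)"
      by (simp only: sum.distrib sum_distrib_left[symmetric] mult.assoc) (simp add: n_def)
    finally show ?thesis unfolding excess excess_sq tb .
  qed
  have deg_pos: "d u \<ge> 1" if "(u, v) \<in> E" for u v
  proof -
    have "finite (E `` {u})" by (rule finite_subset[OF _ fin]) (use E(1) in auto)
    then have "card (E `` {u}) > 0" using that by (auto simp: card_gt_0_iff)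
    then show ?thesis by (simp add: d_def)
  qed
  have "(\<Sum>(u, v)\<in>E. 1 + t * (d u - 1) + t * (d v - 1)) \<le> (\<Sum>(u, v)\<in>E. x u * x v)"
  proof (intro sum_mono, clarify)
    fix u v assume uv: "(u, v) \<in> E"
    then have "(v, u) \<in> E" using E(2) by (auto dest: symD)
    with uv have "0 \<le> (t * (d u - 1)) * (t * (d v - 1))"
      using t deg_pos by (intro mult_nonneg_nonneg) force+
    then show "1 + t * (d u - 1) + t * (d v - 1) \<le> x u * x v"
      by (simp add: x algebra_simps)
  qed
  moreover have "(\<Sum>(u, v)\<in>E. 1 + t * (d u - 1) + t * (d v - 1))
      = card E + 2 * (t * (\<Sum>v\<in>V. d v * (d v - 1)))"
  proof -
    have "(\<Sum>(u, v)\<in>E. t * (d u - 1)) = t * (\<Sum>v\<in>V. d v * (d v - 1))"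
      by (subst sum_over_arcs_tail[OF fin E(1)]) (simp add: d_def sum_distrib_left mult_ac)
    moreover have "(\<Sum>(u, v)\<in>E. t * (d v - 1)) = t * (\<Sum>v\<in>V. d v * (d v - 1))"
      by (subst sum_over_arcs_head[OF fin E]) (simp add: d_def sum_distrib_left mult_ac)
    ultimately show ?thesis by (simp add: case_prod_beta sum.distrib)
  qed
  ultimately have arcs: "n + (r - 1) * (r - n) + 2 * t * f + 4 * (r - n) \<le> (\<Sum>(u, v)\<in>E. x u * x v)"
    unfolding degree_excess distrib_left card_E using tb by simp
  have "r\<^sup>2 - (n + 2 * (r - n) + t\<^sup>2 * (f + (r - 1) * (r - n)))
      + (n + (r - 1) * (r - n) + 2 * t * f + 4 * (r - n))
    = r * (n + 2 * (r - n) + t\<^sup>2 * (f + (r - 1) * (r - n)))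
      + t\<^sup>2 * ((r - 3) * f - 2 * ((r - 1) * (r - n)))" (is "?L = ?R")
  proof -
    \<comment> \<open>The difference of the two sides is a multiple of \<open>1 - t * (r - 1)\<close>, which vanishes.\<close>
    have "?L - ?R = (1 - t * (r - 1)) * (2 * f * t + (1 + t * (r - 1)) * (r - n))"
      by (simp add: algebra_simps power2_eq_square)
    then show ?thesis using t(2) by simp
  qed
  moreover have "((r - 3) * f - 2 * (real (card E) - card V)) / (r - 1)\<^sup>2
      = t\<^sup>2 * ((r - 3) * f - 2 * ((r - 1) * (r - n)))"
    by (simp add: b n_def t_def power_divide)
  ultimately show ?thesis
    unfolding diameter_two_form_eq[OF fin E(1)] sum_x f_def[symmetric] using arcs sum_sq_x by simp
qed

section \<open>Graphs and their complements\<close>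

lemma pverts_graph_complement [simp]: "pverts (graph_complement G) = pverts G"
  by (simp add: graph_complement_def)

lemma parcs_graph_complement_iff:
  "(u, v) \<in> parcs (graph_complement G) \<longleftrightarrow>
    u \<in> pverts G \<and> v \<in> pverts G \<and> u \<noteq> v \<and> (u, v) \<notin> parcs G"
  by (simp add: graph_complement_def)

lemma out_degree_eq_card_Image: "out_degree (with_proj G) v = card (parcs G `` {v})"
proof -
  have "out_arcs (with_proj G) v = Pair v ` (parcs G `` {v})" by (auto simp: out_arcs_def)
  then show ?thesis unfolding out_degree_def by (simp add: card_image inj_on_def)
qed

context pair_graph
begin

lemma parcs_subset: "parcs G \<subseteq> pverts G \<times> pverts G"
  using in_arcsD1 in_arcsD2 by auto

lemma sym_parcs: "sym (parcs G)"
  using arcs_symmetric by (auto intro: symI)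

lemma pair_graph_complement: "pair_graph (graph_complement G)"
proof (unfold_locales)
  show "finite (parcs (graph_complement G))"
    by (rule finite_subset[of _ "pverts G \<times> pverts G"]) (auto simp: graph_complement_def)
  show "symmetric (with_proj (graph_complement G))"
    using arcs_symmetric by (auto simp: symmetric_def graph_complement_def intro!: symI)
qed (auto simp: graph_complement_def)

lemma degree_add_complement_degree:
  assumes "v \<in> pverts G"
  shows "card (parcs G `` {v}) + card (parcs (graph_complement G) `` {v}) = card (pverts G) - 1"
proof -
  have "parcs G `` {v} \<union> parcs (graph_complement G) `` {v} = pverts G - {v}"
    using assms in_arcsD2 no_loops' by (auto simp: graph_complement_def)
  moreover have "parcs G `` {v} \<inter> parcs (graph_complement G) `` {v} = {}"
    by (auto simp: graph_complement_def)
  moreover have "finite (parcs G `` {v} \<union> parcs (graph_complement G) `` {v})"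
    unfolding calculation(1) by simp
  ultimately show ?thesis using assms by (metis card_Diff_singleton card_Un_disjoint finite_Un)
qed

lemma card_arcs_add_complement:
  "real (card (parcs G)) + card (parcs (graph_complement G))
    = real (card (pverts G)) * (real (card (pverts G)) - 1)"
proof -
  interpret H: pair_graph "graph_complement G" by (rule pair_graph_complement)
  have "real (card (parcs G)) + card (parcs (graph_complement G))
    = (\<Sum>v\<in>pverts G. real (card (parcs G `` {v}) + card (parcs (graph_complement G) `` {v})))"
    using card_arcs_eq_sum_degrees[OF pair_finite_verts parcs_subset]
      card_arcs_eq_sum_degrees[OF H.pair_finite_verts H.parcs_subset]
    by (simp add: sum.distrib)
  also have "\<dots> = (\<Sum>v\<in>pverts G. real (card (pverts G)) - 1)"
  proof (intro sum.cong refl)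
    fix v assume "v \<in> pverts G"
    then have "card (pverts G) \<ge> 1" by (auto simp: Suc_le_eq card_gt_0_iff)
    then show "real (card (parcs G `` {v}) + card (parcs (graph_complement G) `` {v}))
        = real (card (pverts G)) - 1"
      using degree_add_complement_degree[OF \<open>v \<in> pverts G\<close>] by simp
  qed
  finally show ?thesis by simp
qed

lemma card_parcs_eq_twice_edges: "card (parcs G) = 2 * card (graph_edges G)"
proof -
  define \<epsilon> where "\<epsilon> a = {fst a, snd a}" for a :: "'a \<times> 'a"
  have edges: "graph_edges G = \<epsilon> ` parcs G" by (force simp: graph_edges_def \<epsilon>_def)
  have "card (parcs G) = (\<Sum>e\<in>\<epsilon> ` parcs G. \<Sum>a\<in>{a \<in> parcs G. \<epsilon> a = e}. 1)"
    using sum.image_gen[of "parcs G" "\<lambda>_. 1::nat" \<epsilon>] by simp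
  also have "\<dots> = (\<Sum>e\<in>\<epsilon> ` parcs G. 2)"
  proof (intro sum.cong refl)
    fix e assume "e \<in> \<epsilon> ` parcs G"
    then obtain u v where uv: "(u, v) \<in> parcs G" "e = {u, v}" by (auto simp: \<epsilon>_def)
    then have "{a \<in> parcs G. \<epsilon> a = e} = {(u, v), (v, u)}"
      using arcs_symmetric by (auto simp: \<epsilon>_def doubleton_eq_iff)
    then show "(\<Sum>a\<in>{a \<in> parcs G. \<epsilon> a = e}. 1) = (2::nat)"
      using no_loops'[OF uv(1)] by simp
  qed
  finally show ?thesis by (simp add: edges)
qed

text \<open>
  Distances between nonadjacent distinct vertices are at least 2, so the distance matrix dominates
  \<open>J - I + A\<close> entrywise, where \<open>A\<close> belongs to the complement; on nonnegative vectors the quadratic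
  forms compare accordingly.
\<close>

lemma test_vector_le_distance_spectral_radius:
  assumes conn: "Digraph_Component.connected (with_proj G)"
    and x: "\<And>v. v \<in> pverts G \<Longrightarrow> 0 \<le> x v"
  shows "(\<Sum>u\<in>pverts G. \<Sum>v\<in>pverts G.
      (of_bool (u \<noteq> v) + of_bool ((u, v) \<in> parcs (graph_complement G))) * x u * x v)
    \<le> distance_spectral_radius G * (\<Sum>u\<in>pverts G. (x u)\<^sup>2)"
proof -
  have "(\<Sum>u\<in>pverts G. \<Sum>v\<in>pverts G.
      (of_bool (u \<noteq> v) + of_bool ((u, v) \<in> parcs (graph_complement G))) * x u * x v)
    \<le> (\<Sum>u\<in>pverts G. \<Sum>v\<in>pverts G. graph_dist G u v * x u * x v)"
  proof (intro sum_mono mult_right_mono x)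
    fix u v assume uv: "u \<in> pverts G" "v \<in> pverts G"
    show "of_bool (u \<noteq> v) + of_bool ((u, v) \<in> parcs (graph_complement G)) \<le> graph_dist G u v"
    proof (cases "u = v")
      case True
      then show ?thesis using graph_dist_self[OF conn uv(1)] by (simp add: graph_complement_def)
    next
      case False
      then show ?thesis using graph_dist_lower[OF conn uv False] by simp
    qed
  qed
  also have "\<dots> \<le> distance_spectral_radius G * (\<Sum>u\<in>pverts G. (x u)\<^sup>2)"
    by (rule rayleigh_le_distance_spectral_radius[OF pair_graph conn])
  finally show ?thesis .
qed

lemma distance_spectral_radius_le_if_diameter_two:
  assumes conn: "Digraph_Component.connected (with_proj G)"
    and diam: "\<And>a b. (a, b) \<in> parcs (graph_complement G) \<Longrightarrow>
      \<exists>w. (a, w) \<in> parcs G \<and> (w, b) \<in> parcs G"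
    and pos: "\<And>v. v \<in> pverts G \<Longrightarrow> real (card (parcs (graph_complement G) `` {v})) < c + 1"
    and weights: "(\<Sum>v\<in>pverts G. 1 / (c + 1 - card (parcs (graph_complement G) `` {v}))) \<le> 1"
  shows "distance_spectral_radius G \<le> c"
proof (rule distance_spectral_radius_le[OF pair_graph conn])
  interpret H: pair_graph "graph_complement G" by (rule pair_graph_complement)
  fix x :: "'a \<Rightarrow> real"
  have "(\<Sum>u\<in>pverts G. \<Sum>v\<in>pverts G. graph_dist G u v * x u * x v)
    = (\<Sum>u\<in>pverts G. \<Sum>v\<in>pverts G.
        (of_bool (u \<noteq> v) + of_bool ((u, v) \<in> parcs (graph_complement G))) * x u * x v)"
  proof (intro sum.cong refl)
    fix u v assume uv: "u \<in> pverts G" "v \<in> pverts G"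
    have "graph_dist G u v = of_bool (u \<noteq> v) + of_bool ((u, v) \<in> parcs (graph_complement G))"
    proof (cases "u = v")
      case True
      then show ?thesis using graph_dist_self[OF conn uv(1)] by (simp add: graph_complement_def)
    next
      case False
      then show ?thesis using graph_dist_diameter_two[OF conn diam uv False] by simp
    qed
    then show "graph_dist G u v * x u * x v
      = (of_bool (u \<noteq> v) + of_bool ((u, v) \<in> parcs (graph_complement G))) * x u * x v" by simp
  qed
  also have "\<dots> \<le> c * (\<Sum>u\<in>pverts G. (x u)\<^sup>2)"
    using diameter_two_form_le[OF pair_finite_verts _ H.sym_parcs pos weights] H.parcs_subset by simp
  finally show "(\<Sum>u\<in>pverts G. \<Sum>v\<in>pverts G. graph_dist G u v * x u * x v)
    \<le> c * (\<Sum>u\<in>pverts G. (x u)\<^sup>2)" .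
qed

text \<open>
  The Rayleigh quotient of the all-ones vector, that is, the average row sum of \<open>J - I + A\<close>.
\<close>

lemma distance_spectral_radius_ge_average:
  assumes conn: "Digraph_Component.connected (with_proj G)"
  shows "2 * real (card (pverts G)) * (real (card (pverts G)) - 1) - real (card (parcs G))
    \<le> distance_spectral_radius G * card (pverts G)"
proof -
  interpret H: pair_graph "graph_complement G" by (rule pair_graph_complement)
  show ?thesis
    using test_vector_le_distance_spectral_radius[OF conn, of "\<lambda>_. 1"] card_arcs_add_complement
      diameter_two_form_eq[OF pair_finite_verts, of "parcs (graph_complement G)" "\<lambda>_. 1"]
      H.parcs_subset
    by (simp add: case_prod_beta power2_eq_square algebra_simps)
qed

text \<open>
  One degree outside \<open>{1, 2}\<close> contributes at least 2 to \<open>f = \<Sum>(d - 1) * (d - 2)\<close>, and then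
  \<open>(r - 3) * f \<ge> 2 * (n - 3)\<close> exceeds the loss term of the test vector \<open>x = 1 + (d - 1) / (r - 1)\<close>.
\<close>

lemma distance_spectral_radius_gt_if_degree_not_1_or_2:
  assumes conn: "Digraph_Component.connected (with_proj G)"
    and n: "n = real (card (pverts G))"
    and r: "r \<ge> n" "n > 3"
    and b: "real (card (parcs (graph_complement G))) - n = (r - 1) * (r - n)"
    and small: "real (card (parcs (graph_complement G))) - n < n - 3"
    and bad: "v \<in> pverts G" "card (parcs (graph_complement G) `` {v}) \<notin> {1, 2}"
  shows "r < distance_spectral_radius G"
proof -
  interpret H: pair_graph "graph_complement G" by (rule pair_graph_complement)
  define d where "d v = real (card (parcs (graph_complement G) `` {v}))" for v
  define x where "x v = 1 + (d v - 1) / (r - 1)" for v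
  define f where "f = (\<Sum>v\<in>pverts G. (d v - 1) * (d v - 2))"
  have term_ge: "(d w - 1) * (d w - 2) \<ge> (if d w \<in> {1, 2} then 0 else 2)" for w
  proof -
    define k where "k = card (parcs (graph_complement G) `` {w})"
    consider "k = 0" | "k = 1" | "k = 2" | "k \<ge> 3" by linarith
    then show ?thesis
    proof cases
      case 4
      then have "(real k - 1) * (real k - 2) \<ge> 2 * 1" by (intro mult_mono) auto
      then show ?thesis using 4 by (simp add: d_def k_def)
    qed (auto simp: d_def k_def)
  qed
  have "2 \<le> (d v - 1) * (d v - 2)" using term_ge[of v] bad by (simp add: d_def split: if_splits)
  also have "\<dots> \<le> f"
    unfolding f_def using bad(1)
  proof (intro member_le_sum)
    show "0 \<le> (d w - 1) * (d w - 2)" for w using term_ge[of w] by (simp split: if_splits)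
  qed auto
  finally have "f \<ge> 2" .
  then have "(n - 3) * 2 \<le> (r - 3) * f" using r by (intro mult_mono) auto
  then have gain: "0 < ((r - 3) * f - 2 * (real (card (parcs (graph_complement G))) - n)) / (r - 1)\<^sup>2"
    using small r by (intro divide_pos_pos) auto
  have x_pos: "x w > 0" for w
  proof -
    have "(d w - 1) / (r - 1) \<ge> - 1 / (r - 1)"
      using r by (intro divide_right_mono) (auto simp: d_def)
    moreover have "1 / (r - 1) < 1" using r by simp
    ultimately show ?thesis by (simp add: x_def)
  qed
  have "r * (\<Sum>v\<in>pverts G. (x v)\<^sup>2)
    < r * (\<Sum>v\<in>pverts G. (x v)\<^sup>2)
      + ((r - 3) * f - 2 * (real (card (parcs (graph_complement G))) - n)) / (r - 1)\<^sup>2"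
    using gain by simp
  also have "\<dots> \<le> (\<Sum>u\<in>pverts G. \<Sum>v\<in>pverts G.
      (of_bool (u \<noteq> v) + of_bool ((u, v) \<in> parcs (graph_complement G))) * x u * x v)"
    using degree_test_vector_form_ge[of "pverts G" "parcs (graph_complement G)" r]
      H.parcs_subset H.sym_parcs r b
    unfolding n f_def x_def d_def by simp
  also have "\<dots> \<le> distance_spectral_radius G * (\<Sum>u\<in>pverts G. (x u)\<^sup>2)"
    using x_pos by (intro test_vector_le_distance_spectral_radius[OF conn]) (simp add: less_imp_le)
  finally show ?thesis
    by (rule mult_right_less_imp_less) (auto intro: sum_nonneg)
qed

end

section \<open>Complements of subgraphs of a path\<close>

definition path_arcs :: "nat set \<Rightarrow> (nat \<times> nat) set" where
  "path_arcs K = (\<lambda>i. (i, Suc i)) ` K \<union> (\<lambda>i. (Suc i, i)) ` K"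

definition path_complement :: "nat \<Rightarrow> nat set \<Rightarrow> nat pair_pre_digraph" where
  "path_complement n K =
    \<lparr> pverts = {..<n}, parcs = {(i, j). i < n \<and> j < n \<and> i \<noteq> j \<and> (i, j) \<notin> path_arcs K} \<rparr>"

lemma path_arcs_iff: "(i, j) \<in> path_arcs K \<longleftrightarrow> j = Suc i \<and> i \<in> K \<or> i = Suc j \<and> j \<in> K"
  by (auto simp: path_arcs_def)

lemma card_path_arcs:
  assumes "finite K" shows "card (path_arcs K) = 2 * card K"
proof -
  have "(\<lambda>i. (i, Suc i)) ` K \<inter> (\<lambda>i. (Suc i, i)) ` K = {}" by auto
  then have "card (path_arcs K) = card ((\<lambda>i. (i, Suc i)) ` K) + card ((\<lambda>i. (Suc i, i)) ` K)"
    unfolding path_arcs_def using assms by (intro card_Un_disjoint) auto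
  then show ?thesis by (simp add: card_image inj_on_def)
qed

lemma path_arcs_Image:
  "path_arcs K `` {i} = (if i \<in> K then {Suc i} else {}) \<union> (if i > 0 \<and> i - 1 \<in> K then {i - 1} else {})"
  by (auto simp: path_arcs_iff)

lemma card_path_arcs_Image_le: "card (path_arcs K `` {i}) \<le> 2"
  unfolding path_arcs_Image by (auto simp: card_insert_if)

lemma card_path_arcs_Image_ge:
  "i \<in> K \<or> (i > 0 \<and> i - 1 \<in> K) \<Longrightarrow> 1 \<le> card (path_arcs K `` {i})"
  unfolding path_arcs_Image by (cases i) (auto simp: card_insert_if)

lemma pair_graph_path_complement: "pair_graph (path_complement n K)"
proof (unfold_locales)
  show "finite (parcs (path_complement n K))"
    by (rule finite_subset[of _ "{..<n} \<times> {..<n}"]) (auto simp: path_complement_def)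
  show "symmetric (with_proj (path_complement n K))"
    by (auto simp: symmetric_def path_complement_def path_arcs_iff intro!: symI)
qed (auto simp: path_complement_def)

lemma complement_path_complement:
  assumes "K \<subseteq> {..<n - 1}"
  shows "parcs (graph_complement (path_complement n K)) = path_arcs K"
  using assms by (fastforce simp: graph_complement_def path_complement_def path_arcs_iff)

text \<open>
  An arc of the complement joins \<open>k\<close> and \<open>k + 1\<close>, so a common neighbour in the graph is a vertex
  joined to neither of them in the complement. Five vertices leave room for one; so does a third
  vertex if \<open>K\<close> has only even elements, since the complement is then a matching.
\<close>

lemma path_complement_common_neighbour:
  assumes "n \<ge> 5 \<or> n \<ge> 3 \<and> (\<forall>i\<in>K. even i)" and K: "K \<subseteq> {..<n - 1}"
    and "(a, b) \<in> path_arcs K"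
  shows "\<exists>w. (a, w) \<in> parcs (path_complement n K) \<and> (w, b) \<in> parcs (path_complement n K)"
proof -
  define k where "k = min a b"
  have k: "k \<in> K" "{a, b} = {k, Suc k}" using assms(3) by (auto simp: path_arcs_iff k_def)
  then have "Suc k < n" using K by auto
  \<comment> \<open>For \<open>k \<le> 1\<close> vertex 4 lies beyond the path neighbour \<open>k + 2 \<le> 3\<close> of \<open>k + 1\<close>; if there is no vertex 4, then \<open>k = 0\<close> and the edge \<open>{1, 2}\<close> is absent because 1 is odd.\<close>
  define w :: nat where "w = (if k \<ge> 2 then 0 else if n \<ge> 5 then 4 else 2)"
  have w: "w < n" "w \<noteq> k" "w \<noteq> Suc k" "(k, w) \<notin> path_arcs K" "(Suc k, w) \<notin> path_arcs K"
    "(w, k) \<notin> path_arcs K" "(w, Suc k) \<notin> path_arcs K"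
    using assms(1) k(1) \<open>Suc k < n\<close> by (auto simp: w_def path_arcs_iff less_2_cases_iff not_le)
  have "a \<in> {k, Suc k}" "b \<in> {k, Suc k}" using k(2) by auto
  then have "(a, w) \<in> parcs (path_complement n K) \<and> (w, b) \<in> parcs (path_complement n K)"
    using w \<open>Suc k < n\<close> by (auto simp: path_complement_def)
  then show ?thesis by blast
qed

lemma (in pair_graph) connected_if_diameter_two:
  assumes ne: "pverts G \<noteq> {}"
    and diam: "\<And>a b. (a, b) \<in> parcs (graph_complement G) \<Longrightarrow>
      \<exists>w. (a, w) \<in> parcs G \<and> (w, b) \<in> parcs G"
  shows "Digraph_Component.connected (with_proj G)"
proof (rule connectedI)
  show "pverts G \<noteq> {}" by (rule ne)
next
  fix u v assume uv: "u \<in> pverts G" "v \<in> pverts G"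
  have "u \<rightarrow>\<^sup>*\<^bsub>with_proj G\<^esub> v"
  proof (cases "u = v \<or> (u, v) \<in> parcs G")
    case True
    then show ?thesis using uv by (auto intro: reachable_adjI)
  next
    case False
    then obtain w where "(u, w) \<in> parcs G" "(w, v) \<in> parcs G"
      using diam uv by (force simp: parcs_graph_complement_iff)
    then show ?thesis by (meson adj_reachable_trans reachable_adjI dominatesI with_proj_simps)
  qed
  then show "u \<rightarrow>\<^sup>*\<^bsub>with_proj (mk_symmetric (with_proj G))\<^esub> v" by (rule reachable_mk_symmetricI)
qed

text \<open>
  The edges of the complement of a competitor are \<open>{i, i + 1}\<close> for \<open>i \<in> K\<close>. If \<open>2 * s + 2 \<le> n\<close>,
  deleting the edges \<open>{1, 2}, {3, 4}, \<dots>, {2 * s - 1, 2 * s}\<close> from the path on \<open>n\<close> vertices leaves \<open>s\<close> single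
  edges followed by a path with at least two vertices, so no vertex is isolated. Otherwise so few
  edges are wanted that a matching has room for them.
\<close>

lemma path_edge_selection:
  assumes "n \<ge> 3" "1 \<le> s" "s \<le> n - 1"
  shows "\<exists>K. K \<subseteq> {..<n - 1} \<and> card K = n - 1 - s \<and> (n \<ge> 5 \<or> n \<ge> 3 \<and> (\<forall>i\<in>K. even i)) \<and>
    (2 * s + 2 \<le> n \<longrightarrow> (\<forall>i<n. i \<in> K \<or> (i > 0 \<and> i - 1 \<in> K)))"
proof (cases "2 * s + 2 \<le> n")
  case True
  define R where "R = (\<lambda>j. 2 * j + 1) ` {..<s}"
  have R: "R \<subseteq> {..<n - 1}" "card R = s"
    using True by (auto simp: R_def card_image inj_on_def)
  define K where "K = {..<n - 1} - R"
  have "card K = n - 1 - s" unfolding K_def using R by (simp add: card_Diff_subset finite_subset)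
  moreover have "even i" if "i \<in> K" "n < 5" for i
  proof -
    \<comment> \<open>Below five vertices only \<open>n = 4\<close> is possible, where \<open>K\<close> is a perfect matching and its complement the 4-cycle.\<close>
    have "n = 4" "s = 1" using True \<open>n < 5\<close> assms by auto
    then have "i \<in> {0, 2}" using that by (auto simp: K_def R_def lessThan_Suc)
    then show ?thesis by auto
  qed
  moreover have "i \<in> K \<or> (i > 0 \<and> i - 1 \<in> K)" if "i < n" for i
  proof (cases "i \<in> K")
    case False
    then have "i = n - 1 \<or> i \<in> R" using that by (auto simp: K_def)
    then consider "i = n - 1" | j where "j < s" "i = 2 * j + 1"
      by (auto simp: R_def)
    then show ?thesis
    proof cases
      case 1
      then have "i - 1 = n - 2" "i > 0" using assms by auto
      moreover have "n - 2 \<notin> R" using True by (auto simp: R_def)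
      moreover have "n - 2 < n - 1" using assms by simp
      ultimately show ?thesis by (simp add: K_def)
    next
      case (2 j)
      have "2 * j \<noteq> 2 * l + 1" for l by presburger
      then show ?thesis using 2 that by (auto simp: K_def R_def)
    qed
  qed simp
  ultimately show ?thesis using assms unfolding K_def by (intro exI[of _ K]) (auto simp: K_def)
next
  case False
  define K where "K = (\<lambda>j. 2 * j) ` {..<n - 1 - s}"
  have "K \<subseteq> {..<n - 1}" "card K = n - 1 - s" "\<forall>i\<in>K. even i"
    using False by (auto simp: K_def card_image inj_on_def)
  then show ?thesis using False assms by blast
qed

text \<open>
  The larger root of the quadratic \<open>(r - 1) * (r - n) = b\<close>; its discriminant is \<open>(n - 1)\<^sup>2 + 4 * b\<close>.
\<close>

lemma extremal_radius_equation:
  fixes n b :: real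
  assumes "n \<ge> 1" "b \<ge> 0"
  obtains r where "r \<ge> n" "(r - 1) * (r - n) = b"
proof
  define S where "S = sqrt ((n - 1)\<^sup>2 + 4 * b)"
  have "n - 1 = sqrt ((n - 1)\<^sup>2)" using assms by simp
  also have "\<dots> \<le> S" unfolding S_def using assms by (intro real_sqrt_le_mono) simp
  finally show "(n + 1 + S) / 2 \<ge> n" by simp
  have "S * S = (n - 1)\<^sup>2 + 4 * b" unfolding S_def using assms by simp
  then show "((n + 1 + S) / 2 - 1) * ((n + 1 + S) / 2 - n) = b"
    by (simp add: field_simps power2_eq_square)
qed

context
  fixes m n s :: nat and K :: "nat set"
  assumes n: "n \<ge> 3" and s: "1 \<le> s" "s \<le> n - 1" and m: "2 * m = (n - 1) * (n - 2) + 2 * s"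
    and K: "K \<subseteq> {..<n - 1}" "card K = n - 1 - s" "n \<ge> 5 \<or> n \<ge> 3 \<and> (\<forall>i\<in>K. even i)"
begin

interpretation P: pair_graph "path_complement n K" by (rule pair_graph_path_complement)

lemma pverts_path_complement: "pverts (path_complement n K) = {..<n}"
  by (simp add: path_complement_def)

lemma path_complement_diameter_two:
  "(a, b) \<in> parcs (graph_complement (path_complement n K)) \<Longrightarrow>
    \<exists>w. (a, w) \<in> parcs (path_complement n K) \<and> (w, b) \<in> parcs (path_complement n K)"
  unfolding complement_path_complement[OF K(1)]
  by (rule path_complement_common_neighbour[OF K(3,1)])

lemma connected_path_complement:
  "Digraph_Component.connected (with_proj (path_complement n K))"
proof (rule P.connected_if_diameter_two)
  show "pverts (path_complement n K) \<noteq> {}" using n by (auto simp: path_complement_def lessThan_empty_iff)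
qed (rule path_complement_diameter_two)

lemma card_path_arcs_K: "real (card (path_arcs K)) = 2 * (real n - 1 - real s)"
  using s n K(2) card_path_arcs[OF finite_subset[OF K(1)]] by (simp add: of_nat_diff)

lemma path_complement_mem: "path_complement n K \<in> connected_graphs_with_edges m"
proof -
  have "real (2 * card (graph_edges (path_complement n K))) + 2 * (real n - 1 - real s)
      = real n * (real n - 1)"
    using P.card_arcs_add_complement card_path_arcs_K
    unfolding complement_path_complement[OF K(1)] P.card_parcs_eq_twice_edges pverts_path_complement
    by simp
  moreover have "real (2 * m) = (real n - 1) * (real n - 2) + 2 * real s"
    unfolding m using n by (simp add: of_nat_diff)
  ultimately have "real (card (graph_edges (path_complement n K))) = real m"
    by (simp add: algebra_simps)
  then show ?thesis
    using connected_path_complement P.pair_graph by (simp add: connected_graphs_with_edges_def)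
qed

text \<open>
  With degrees at most 2 each of the \<open>n\<close> weights \<open>1 / (n + 2 - d)\<close> is at most \<open>1 / n\<close>.
\<close>

lemma path_complement_radius_le_Suc:
  "distance_spectral_radius (path_complement n K) \<le> real n + 1"
proof (rule P.distance_spectral_radius_le_if_diameter_two[OF connected_path_complement
      path_complement_diameter_two])
  have d: "real (card (parcs (graph_complement (path_complement n K)) `` {v})) \<le> 2" for v
    using card_path_arcs_Image_le[of K v] unfolding complement_path_complement[OF K(1)] by simp
  show "real (card (parcs (graph_complement (path_complement n K)) `` {v})) < real n + 1 + 1" for v
    using d[of v] n by simp
  have "(\<Sum>v\<in>pverts (path_complement n K).
      1 / (real n + 1 + 1 - card (parcs (graph_complement (path_complement n K)) `` {v})))
    \<le> (\<Sum>v\<in>pverts (path_complement n K). 1 / real n)"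
  proof (intro sum_mono)
    fix v
    have "real n \<le> real n + 1 + 1 - card (parcs (graph_complement (path_complement n K)) `` {v})"
      using d[of v] by simp
    then show "1 / (real n + 1 + 1 - card (parcs (graph_complement (path_complement n K)) `` {v}))
        \<le> 1 / real n"
      using n by (intro divide_left_mono mult_pos_pos) auto
  qed
  also have "\<dots> \<le> 1" using n by (simp add: pverts_path_complement)
  finally show "(\<Sum>v\<in>pverts (path_complement n K).
      1 / (real n + 1 + 1 - card (parcs (graph_complement (path_complement n K)) `` {v}))) \<le> 1" .
qed

text \<open>
  With degrees in \<open>{1, 2}\<close> the weight \<open>1 / (r + 1 - d)\<close> is an affine function of \<open>d\<close>, so the weights sum
  to \<open>n / r + (\<Sum>(d - 1)) / (r * (r - 1)) = n / r + (r - n) / r = 1\<close>.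
\<close>

lemma path_complement_radius_le_root:
  assumes cover: "\<And>i. i < n \<Longrightarrow> i \<in> K \<or> (i > 0 \<and> i - 1 \<in> K)"
    and r: "r \<ge> real n" "(r - 1) * (r - real n) = real n - 2 - 2 * real s"
  shows "distance_spectral_radius (path_complement n K) \<le> r"
proof (rule P.distance_spectral_radius_le_if_diameter_two[OF connected_path_complement
      path_complement_diameter_two])
  define d where "d v = real (card (parcs (graph_complement (path_complement n K)) `` {v}))" for v
  have d_12: "d v = 1 \<or> d v = 2" if "v < n" for v
    using card_path_arcs_Image_le[of K v] card_path_arcs_Image_ge[OF cover[OF that]]
    unfolding d_def complement_path_complement[OF K(1)] by auto
  show "real (card (parcs (graph_complement (path_complement n K)) `` {v})) < r + 1"
    if "v \<in> pverts (path_complement n K)" for v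
    using d_12[of v] that n r by (auto simp: pverts_path_complement d_def[symmetric])
  have "(\<Sum>v<n. d v - 1) = real n - 2 - 2 * real s"
  proof -
    interpret H: pair_graph "graph_complement (path_complement n K)" by (rule P.pair_graph_complement)
    have "real (card (path_arcs K)) = (\<Sum>v<n. d v)"
      using card_arcs_eq_sum_degrees[OF H.pair_finite_verts H.parcs_subset]
      by (simp add: d_def pverts_path_complement complement_path_complement[OF K(1)])
    then show ?thesis using card_path_arcs_K by (simp add: sum_subtractf)
  qed
  then have excess: "(\<Sum>v<n. d v - 1) = (r - 1) * (r - real n)" using r by simp
  have "(\<Sum>v\<in>pverts (path_complement n K).
      1 / (r + 1 - card (parcs (graph_complement (path_complement n K)) `` {v})))
    = (\<Sum>v<n. 1 / r + (d v - 1) * (1 / (r * (r - 1))))"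
    unfolding pverts_path_complement d_def[symmetric]
  proof (intro sum.cong refl)
    fix v assume "v \<in> {..<n}"
    then have "d v = 1 \<or> d v = 2" using d_12 by simp
    then show "1 / (r + 1 - d v) = 1 / r + (d v - 1) * (1 / (r * (r - 1)))"
      using n r by (auto simp: divide_simps) 
  qed
  also have "\<dots> = real n / r + (\<Sum>v<n. d v - 1) * (1 / (r * (r - 1)))"
    by (simp add: sum.distrib sum_divide_distrib)
  also have "\<dots> = 1" unfolding excess using n r by (simp add: field_simps)
  finally show "(\<Sum>v\<in>pverts (path_complement n K).
      1 / (r + 1 - card (parcs (graph_complement (path_complement n K)) `` {v}))) \<le> 1" by simp
qed

end

section \<open>Order and complement degrees of extremal graphs\<close>

lemma two_times_choose_two: "2 * (n choose 2) = n * (n - 1)"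
  by (cases n) (simp_all add: choose_two)

text \<open>
  The ceiling places \<open>sqrt (8 * m)\<close> in \<open>(2 * n - 3, 2 * n - 1]\<close>. Squaring and using
  \<open>(2 * n - 1)\<^sup>2 = 4 * n * (n - 1) + 1\<close>, the summand 1 disappears by divisibility by 4. So \<open>n\<close> is the least
  order of a graph with \<open>m\<close> edges.
\<close>

lemma ceiling_order_bounds:
  fixes m n :: nat
  assumes m: "m \<ge> 3" and n: "n = nat \<lceil>(1 + sqrt (8 * real m)) / 2\<rceil>"
  shows "(n - 1) * (n - 2) < 2 * m" "2 * m \<le> n * (n - 1)" "n \<ge> 3"
proof -
  define x where "x = (1 + sqrt (8 * real m)) / 2"
  have x_pos: "x > 0" by (simp add: x_def add_pos_nonneg)
  then have n_int: "int n = \<lceil>x\<rceil>" by (simp add: n x_def[symmetric])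
  have "x \<le> real n" "real n - 1 < x"
    using le_of_int_ceiling[of x] ceiling_less_iff[of x "int n"] ceiling_correct[of x]
    unfolding n_int[symmetric] by auto
  then have upper: "sqrt (8 * real m) \<le> 2 * real n - 1" and lower: "2 * real n - 3 < sqrt (8 * real m)"
    by (simp_all add: x_def)
  have "real n > 0" using \<open>x \<le> real n\<close> x_pos by linarith
  then have "n \<ge> 1" by simp
  have "(sqrt (8 * real m))\<^sup>2 \<le> (2 * real n - 1)\<^sup>2"
    using upper by (intro power_mono) auto
  then have "8 * real m \<le> 4 * (real n * (real n - 1)) + 1"
    by (simp add: power2_eq_square algebra_simps)
  then have "real (8 * m) \<le> real (4 * (n * (n - 1)) + 1)"
    using \<open>n \<ge> 1\<close> by (simp add: of_nat_diff)
  then have "8 * m \<le> 4 * (n * (n - 1)) + 1" by (simp only: of_nat_le_iff)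
  then show le: "2 * m \<le> n * (n - 1)" by presburger
  show "n \<ge> 3"
  proof (rule ccontr)
    assume "\<not> n \<ge> 3"
    then have "n \<in> {0, 1, 2}" by auto
    then show False using le m by auto
  qed
  then have "(2 * real n - 3)\<^sup>2 < (sqrt (8 * real m))\<^sup>2"
    using lower by (intro power_strict_mono) auto
  then have "4 * ((real n - 1) * (real n - 2)) + 1 < 8 * real m"
    by (simp add: power2_eq_square algebra_simps)
  then have "real (4 * ((n - 1) * (n - 2)) + 1) < real (8 * m)"
    using \<open>n \<ge> 3\<close> by (simp add: of_nat_diff)
  then have "4 * ((n - 1) * (n - 2)) + 1 < 8 * m" by (simp only: of_nat_less_iff)
  then show "(n - 1) * (n - 2) < 2 * m" by presburger
qed

text \<open>
  The extremal graph is compared with complements of subgraphs of a path. Such a graph has radius at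
  most \<open>n + 1\<close>, less than the average row sum possible with more than \<open>n\<close> vertices; on \<open>n\<close> vertices
  and for \<open>2 * s + 2 \<le> n\<close> one of them has radius at most \<open>r\<close>, which a degree outside \<open>{1, 2}\<close> in the
  complement would exceed.
\<close>

lemma extremal_order_and_complement_degrees:
  fixes G :: "'a pair_pre_digraph"
  assumes n: "n \<ge> 3" and s: "1 \<le> s" "s \<le> n - 1" and m: "2 * m = (n - 1) * (n - 2) + 2 * s"
    and G: "G \<in> connected_graphs_with_edges m"
    and extremal: "\<And>G' :: nat pair_pre_digraph. G' \<in> connected_graphs_with_edges m \<Longrightarrow>
           distance_spectral_radius G \<le> distance_spectral_radius G'"
  shows "card (pverts G) = n"
    and "card (parcs (graph_complement G)) = 2 * (n - 1 - s)"
    and "2 * s + 2 \<le> n \<Longrightarrow> v \<in> pverts G \<Longrightarrow> card (parcs (graph_complement G) `` {v}) \<in> {1, 2}"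
proof -
  interpret pair_graph G using G by (simp add: connected_graphs_with_edges_def)
  have conn: "Digraph_Component.connected (with_proj G)" and arcs: "card (parcs G) = 2 * m"
    using G card_parcs_eq_twice_edges by (simp_all add: connected_graphs_with_edges_def)
  define N where "N = real (card (pverts G))"
  have m': "real (card (parcs G)) = (real n - 1) * (real n - 2) + 2 * real s"
    unfolding arcs m using n by (simp add: of_nat_diff)
  obtain K where selection: "K \<subseteq> {..<n - 1} \<and> card K = n - 1 - s \<and>
      (n \<ge> 5 \<or> n \<ge> 3 \<and> (\<forall>i\<in>K. even i)) \<and>
      (2 * s + 2 \<le> n \<longrightarrow> (\<forall>i<n. i \<in> K \<or> (i > 0 \<and> i - 1 \<in> K)))"
    using path_edge_selection[OF n s] by (elim exE)
  note K = selection[THEN conjunct1] selection[THEN conjunct2, THEN conjunct1]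
    selection[THEN conjunct2, THEN conjunct2, THEN conjunct1]
  note cover = selection[THEN conjunct2, THEN conjunct2, THEN conjunct2]
  note competitor = path_complement_mem[OF n s m K]
  have radius_le: "distance_spectral_radius G \<le> real n + 1"
    using extremal[OF competitor] path_complement_radius_le_Suc[OF n s m K] by simp
  have total: "real (card (parcs G)) + card (parcs (graph_complement G)) = N * (N - 1)"
    unfolding N_def by (rule card_arcs_add_complement)
  have N_pos: "N > 0" using connected_pverts_nonempty[OF conn] by (simp add: N_def card_gt_0_iff)
  have "\<not> card (pverts G) \<le> n - 1"
  proof
    assume "card (pverts G) \<le> n - 1"
    then have "N \<le> real n - 1" using n by (simp add: N_def)
    then have "N * (N - 1) \<le> (real n - 1) * (real n - 2)"
      using n N_pos by (cases "N \<ge> 1") (auto intro!: mult_mono simp: N_def)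
    then show False using total m' s by simp
  qed
  moreover have "\<not> card (pverts G) \<ge> n + 1"
  proof
    assume "card (pverts G) \<ge> n + 1"
    then have N: "N \<ge> real n + 1" by (simp add: N_def)
    have "2 * N * (N - 1) - ((real n - 1) * (real n - 2) + 2 * real s) \<le> (real n + 1) * N"
    proof -
      have "2 * N * (N - 1) - real (card (parcs G)) \<le> distance_spectral_radius G * N"
        unfolding N_def by (rule distance_spectral_radius_ge_average[OF conn])
      also have "\<dots> \<le> (real n + 1) * N" using radius_le N_pos by (intro mult_right_mono) auto
      finally show ?thesis unfolding m' .
    qed
    moreover have "(real n - 1) * (real n - 2) + 2 * real s \<le> real n * (real n - 1)"
      using s n by (simp add: algebra_simps of_nat_diff)
    ultimately have "N * (2 * N - real n - 3) \<le> real n * (real n - 1)"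
      by (simp add: algebra_simps)
    moreover have "(real n + 1) * (real n - 1) \<le> N * (2 * N - real n - 3)"
      using N n by (intro mult_mono) auto
    ultimately show False using n by (simp add: algebra_simps)
  qed
  ultimately show card_V: "card (pverts G) = n" by simp
  then have N_eq: "N = real n" by (simp add: N_def)
  have E: "real (card (parcs (graph_complement G))) = 2 * (real n - 1 - real s)"
    using total m' unfolding N_eq by (simp add: algebra_simps)
  then have "real (card (parcs (graph_complement G))) = real (2 * (n - 1 - s))"
    using s n by (simp add: of_nat_diff)
  then show "card (parcs (graph_complement G)) = 2 * (n - 1 - s)" by (simp only: of_nat_eq_iff)
  assume s': "2 * s + 2 \<le> n" and v: "v \<in> pverts G"
  then have b: "real n - 2 - 2 * real s \<ge> 0" by simp
  obtain r where r: "r \<ge> real n" "(r - 1) * (r - real n) = real n - 2 - 2 * real s"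
    using extremal_radius_equation[OF _ b, of "real n"] n by auto
  have "distance_spectral_radius G \<le> r"
    using extremal[OF competitor] path_complement_radius_le_root[OF n s m K cover[rule_format, OF s'] r]
    by (rule order_trans)
  moreover have "r < distance_spectral_radius G"
    if "card (parcs (graph_complement G) `` {v}) \<notin> {1, 2}"
  proof (rule distance_spectral_radius_gt_if_degree_not_1_or_2[OF conn _ r(1) _ _ _ v that])
    show "real n = real (card (pverts G))" by (simp add: card_V)
    show "real n > 3" using s' s by simp
    show "real (card (parcs (graph_complement G))) - real n = (r - 1) * (r - real n)"
      using E r by simp
    show "real (card (parcs (graph_complement G))) - real n < real n - 3" using E s by simp
  qed
  ultimately show "card (parcs (graph_complement G) `` {v}) \<in> {1, 2}" by fastforce
qed

section \<open>Graphs with all degrees one or two\<close>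

text \<open>
  Listing the vertices is an isomorphism onto a graph on \<open>{0..<length p}\<close> as soon as the arcs agree
  position by position.
\<close>

lemma digraph_isoI_list:
  assumes "wf_digraph C" "tail C = fst" "head C = snd"
    and p: "distinct p" "verts C = set p"
    and H: "pverts H = {0..<length p}" "parcs H \<subseteq> {0..<length p} \<times> {0..<length p}"
    and arcs: "\<And>i j. i < length p \<Longrightarrow> j < length p \<Longrightarrow> (p ! i, p ! j) \<in> arcs C \<longleftrightarrow> (i, j) \<in> parcs H"
  shows "digraph_iso C (with_proj H)"
proof -
  interpret C: wf_digraph C by fact
  define g where "g = the_inv_into {0..<length p} (nth p)"
  have bij: "bij_betw (nth p) {0..<length p} (set p)"
    using p(1) by (intro bij_betw_nth) auto
  then have bij_g: "bij_betw g (set p) {0..<length p}"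
    unfolding g_def by (rule bij_betw_the_inv_into)
  have g_nth: "g (p ! i) = i" if "i < length p" for i
    using bij that unfolding g_def by (intro the_inv_into_f_f) (auto simp: bij_betw_def)
  have arc_ends: "\<exists>i j. i < length p \<and> j < length p \<and> a = (p ! i, p ! j)" if "a \<in> arcs C" for a
  proof -
    have "fst a \<in> set p" "snd a \<in> set p"
      using C.wellformed[OF that] assms(2,3) p(2) by auto
    then show ?thesis by (metis in_set_conv_nth prod.collapse)
  qed
  define hom where "hom = \<lparr> iso_verts = g, iso_arcs = map_prod g g, iso_head = snd, iso_tail = fst \<rparr>"
  have "arcs C \<subseteq> set p \<times> set p" using arc_ends by fastforce
  then have inj: "inj_on (map_prod g g) (arcs C)"
    using bij_g by (intro inj_on_subset[OF map_prod_inj_on]) (auto simp: bij_betw_def)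
  have "C.digraph_isomorphism hom"
    unfolding C.digraph_isomorphism_def
    using assms(1-3) inj bij_g p(2) by (auto simp: hom_def bij_betw_def)
  moreover have "map_prod g g ` arcs C = parcs H"
  proof (intro equalityI subsetI)
    fix a assume "a \<in> map_prod g g ` arcs C"
    then obtain c where "c \<in> arcs C" "a = map_prod g g c" by (elim imageE)
    with arc_ends[of c] obtain i j where "i < length p" "j < length p" "(p ! i, p ! j) \<in> arcs C"
      "a = (g (p ! i), g (p ! j))" by auto
    then show "a \<in> parcs H" using arcs g_nth by simp
  next
    fix a assume a: "a \<in> parcs H"
    obtain i j where a_eq: "a = (i, j)" by (cases a)
    then have ij: "a = (i, j)" "i < length p" "j < length p" using a H(2) by auto
    then have "(p ! i, p ! j) \<in> arcs C" using a arcs by simp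
    moreover have "map_prod g g (p ! i, p ! j) = a" using ij g_nth by simp
    ultimately show "a \<in> map_prod g g ` arcs C" by (rule rev_image_eqI[OF _ sym])
  qed
  then have "with_proj H = app_iso hom C"
    using bij_g p(2) H(1) by (simp add: app_iso_def hom_def with_proj_def bij_betw_def)
  ultimately show ?thesis unfolding digraph_iso_def by blast
qed

lemma digraph_iso_cards:
  assumes "digraph_iso C D"
  shows "card (verts C) = card (verts D)" "card (arcs C) = card (arcs D)"
proof -
  obtain f where f: "pre_digraph.digraph_isomorphism C f" "D = app_iso f C"
    using assms by (auto simp: digraph_iso_def)
  show "card (verts C) = card (verts D)" "card (arcs C) = card (arcs D)"
    using card_verts_iso[OF f(1)] card_arcs_iso[OF f(1)] by (simp_all add: f(2))
qed

lemma card_arcs_nontrivial_path: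
  assumes "is_nontrivial_path C"
  shows "card (arcs C) + 2 = 2 * card (verts C)"
proof -
  obtain k where k: "k \<ge> 2" "digraph_iso C (with_proj (path_graph k))"
    using assms by (auto simp: is_nontrivial_path_def)
  have "parcs (path_graph k) = path_arcs {..<k - 1}"
    by (auto simp: path_graph_def path_arcs_iff)
  then show ?thesis
    using k(1) digraph_iso_cards[OF k(2)] by (simp add: card_path_arcs) (simp add: path_graph_def)
qed

lemma card_arcs_cycle:
  assumes "is_cycle C"
  shows "card (arcs C) = 2 * card (verts C)"
proof -
  obtain k where k: "k \<ge> 3" "digraph_iso C (with_proj (cycle_graph k))"
    using assms by (auto simp: is_cycle_def)
  define A where "A = (\<lambda>i. (i, Suc i mod k)) ` {..<k}"
  define B where "B = (\<lambda>i. (Suc i mod k, i)) ` {..<k}"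
  have "parcs (cycle_graph k) = A \<union> B"
    using k(1) by (auto simp: cycle_graph_def A_def B_def)
  moreover have "A \<inter> B = {}"
  proof -
    have "Suc (Suc i mod k) mod k \<noteq> i" if "i < k" for i
    proof -
      have "Suc (Suc i mod k) mod k = (if i + 2 < k then i + 2 else i + 2 - k)"
        using that k(1) by (auto simp: mod_Suc)
      then show ?thesis using that k(1) by auto
    qed
    then show ?thesis by (force simp: A_def B_def)
  qed
  moreover have "card A = k" "card B = k" "finite A" "finite B"
    by (auto simp: A_def B_def card_image inj_on_def)
  ultimately have "card (parcs (cycle_graph k)) = 2 * k" by (simp add: card_Un_disjoint)
  moreover have "card (pverts (cycle_graph k)) = k" by (simp add: cycle_graph_def)
  ultimately show ?thesis using digraph_iso_cards[OF k(2)] by simp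
qed

context pair_graph
begin

text \<open>
  Take a longest path \<open>p\<close> inside the component. Neighbours of its two ends lie on \<open>p\<close> by maximality, and
  an inner vertex has no neighbours besides its two path neighbours because its degree is at most 2.
  So \<open>p\<close> exhausts the component, and the only possible further edge joins the two ends. If the ends
  are joined and \<open>p\<close> has at least three vertices, the component is a cycle, otherwise a path.
\<close>

lemma component_cycle_or_path:
  assumes deg: "\<And>v. v \<in> pverts G \<Longrightarrow> card (parcs G `` {v}) \<in> {1, 2}"
    and C: "C \<in> graph_components G"
  shows "is_cycle C \<or> is_nontrivial_path C"
proof -
  obtain S where S: "S \<in> sccs_verts" and C_eq: "C = with_proj G \<restriction> S"
    using C sccs_conv_sccs_verts by (auto simp: graph_components_def)
  have S_sub: "S \<subseteq> pverts G" by (rule sccs_verts_subsets[OF S])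
  have fin_S: "finite S" by (rule finite_subset[OF S_sub]) simp
  have fin_nb: "finite (parcs G `` {v})" for v
    by (rule finite_subset[of _ "pverts G"]) (use in_arcsD2 in auto)
  have closed: "w \<in> S" if "v \<in> S" "(v, w) \<in> parcs G" for v w
  proof (rule ccontr)
    assume "w \<notin> S"
    moreover have "v \<rightarrow>\<^sup>*\<^bsub>with_proj G\<^esub> w" "w \<rightarrow>\<^sup>*\<^bsub>with_proj G\<^esub> v"
      using that(2) arcs_symmetric by (auto intro: reachable_adjI)
    ultimately show False using S that(1) unfolding in_sccs_verts_conv_reachable by blast
  qed
  define path_in_S where "path_in_S p \<longleftrightarrow> distinct p \<and> set p \<subseteq> S \<and>
      (\<forall>i. Suc i < length p \<longrightarrow> (p ! i, p ! Suc i) \<in> parcs G)" for p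
  obtain u where u: "u \<in> S" using S by (auto simp: in_sccs_verts_conv_reachable)
  have "card (parcs G `` {u}) \<noteq> 0" using deg[of u] u S_sub by auto
  then have "parcs G `` {u} \<noteq> {}" by auto
  then obtain w where w: "(u, w) \<in> parcs G" by blast
  have "path_in_S [u, w]"
    using u w closed[OF u w] no_loops'[OF w] by (auto simp: path_in_S_def less_Suc_eq)
  moreover have bound: "length p \<le> card S" if "path_in_S p" for p
    using that card_mono[OF fin_S, of "set p"] by (simp add: path_in_S_def distinct_card)
  ultimately obtain p where p: "path_in_S p" and longest: "\<And>q. path_in_S q \<Longrightarrow> length q \<le> length p"
    using ex_has_greatest_nat[of path_in_S "[u, w]" length "Suc (card S)"] by (auto simp: less_Suc_eq_le)
  define k where "k = length p"
  have k: "k \<ge> 2" using longest[OF \<open>path_in_S [u, w]\<close>] by (simp add: k_def)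
  have p_dist: "distinct p" and p_S: "set p \<subseteq> S"
    and step: "\<And>i. Suc i < k \<Longrightarrow> (p ! i, p ! Suc i) \<in> parcs G"
    using p by (auto simp: path_in_S_def k_def)
  have p_in_list: "p ! i \<in> set p" if "i < k" for i
    using that by (simp add: k_def)
  have p_in_S: "p ! i \<in> S" if "i < k" for i
    using that p_S nth_mem[of i p] by (auto simp: k_def)
  have p_eq: "p ! i = p ! j \<longleftrightarrow> i = j" if "i < k" "j < k" for i j
    using that p_dist by (simp add: k_def nth_eq_iff_index_eq)
  have inner: "parcs G `` {p ! i} = {p ! (i - 1), p ! Suc i}" if "0 < i" "Suc i < k" for i
  proof (rule card_seteq[symmetric])
    show "{p ! (i - 1), p ! Suc i} \<subseteq> parcs G `` {p ! i}"
      using that step[of "i - 1"] step[of i] arcs_symmetric by auto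
    have "p ! i \<in> pverts G" using that p_in_S[of i] S_sub by auto
    then have "card (parcs G `` {p ! i}) \<le> 2" using deg by force
    also have "2 = card {p ! (i - 1), p ! Suc i}" using that p_eq by simp
    finally show "card (parcs G `` {p ! i}) \<le> card {p ! (i - 1), p ! Suc i}" .
  qed (rule fin_nb)
  have first_end: "x \<in> set p" if x: "(p ! 0, x) \<in> parcs G" for x
  proof (rule ccontr)
    assume "x \<notin> set p"
    moreover have "p ! 0 \<in> S" using p_in_S k by simp
    ultimately have "path_in_S (x # p)"
      using p closed[OF _ x] arcs_symmetric[OF x]
      by (auto simp: path_in_S_def nth_Cons split: nat.split)
    then show False using longest by fastforce
  qed
  \<comment> \<open>A neighbour of an end off \<open>p\<close> would extend \<open>p\<close>, at the front above and at the back here.\<close>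
  have last_end: "x \<in> set p" if x: "(p ! (k - 1), x) \<in> parcs G" for x
  proof (rule ccontr)
    assume "x \<notin> set p"
    moreover have "p ! (k - 1) \<in> S" using p_in_S k by simp
    ultimately have "distinct (p @ [x])" "set (p @ [x]) \<subseteq> S"
      using p_dist p_S closed[OF _ x] by auto
    moreover have "((p @ [x]) ! i, (p @ [x]) ! Suc i) \<in> parcs G" if "Suc i < length (p @ [x])" for i
    proof (cases "Suc i < k")
      case True
      then show ?thesis using step by (simp add: nth_append k_def)
    next
      case False
      then have "i = k - 1" "Suc i = length p" using that k by (auto simp: k_def)
      then show ?thesis using x by (simp add: nth_append)
    qed
    ultimately have "path_in_S (p @ [x])" unfolding path_in_S_def by blast
    then show False using longest by fastforce
  qed
  have arc_cases: "j = Suc i \<or> i = Suc j \<or> i = 0 \<and> j = k - 1 \<or> i = k - 1 \<and> j = 0"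
    if ij: "i < k" "j < k" "(p ! i, p ! j) \<in> parcs G" for i j
  proof -
    have neighbour: "b = a - 1 \<or> b = Suc a"
      if ab: "0 < a" "Suc a < k" "b < k" "(p ! a, p ! b) \<in> parcs G" for a b
    proof -
      have "p ! b \<in> {p ! (a - 1), p ! Suc a}" using inner[OF ab(1,2)] ab(4) by blast
      then show ?thesis using p_eq ab by auto
    qed
    have "i \<noteq> j" using ij no_loops' by blast
    then consider "0 < i" "Suc i < k" | "0 < j" "Suc j < k" | "i = 0 \<and> j = k - 1 \<or> i = k - 1 \<and> j = 0"
      using ij by linarith
    then show ?thesis
    proof cases
      case 1
      then show ?thesis using neighbour[OF 1 ij(2,3)] by auto
    next
      case 2
      then show ?thesis using neighbour[OF 2 ij(1) arcs_symmetric[OF ij(3)]] by auto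
    qed blast
  qed
  have "S = set p"
  proof
    show "S \<subseteq> set p"
    proof
      fix v assume "v \<in> S"
      have "p ! 0 \<in> S" using p_in_S k by simp
      then have "p ! 0 \<rightarrow>\<^sup>*\<^bsub>with_proj G\<^esub> v"
        using S \<open>v \<in> S\<close> by (auto simp: in_sccs_verts_conv_reachable)
      then show "v \<in> set p"
      proof (induct rule: reachable_induct)
        case base
        show ?case using k p_in_list by simp
      next
        case (step x y)
        then obtain i where i: "i < k" "x = p ! i" by (auto simp: in_set_conv_nth k_def)
        have xy: "(p ! i, y) \<in> parcs G" using step i by simp
        consider "i = 0" | "i = k - 1" | "0 < i" "Suc i < k" using i by linarith
        then show ?case
        proof cases
          case 3
          then have "y \<in> {p ! (i - 1), p ! Suc i}" using inner[OF 3] xy by blast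
          then show ?thesis using 3 p_in_list[of "i - 1"] p_in_list[of "Suc i"] by auto
        qed (use first_end last_end xy in auto)
      qed
    qed
  qed (rule p_S)
  have C_parts: "wf_digraph C" "tail C = fst" "head C = snd" "verts C = set p"
    using \<open>S = set p\<close> wellformed_induce_subgraph[of S] by (simp_all add: C_eq)
  have C_arcs: "(p ! i, p ! j) \<in> arcs C \<longleftrightarrow> (p ! i, p ! j) \<in> parcs G" if "i < k" "j < k" for i j
    using that \<open>S = set p\<close> by (simp add: C_eq k_def)
  have consecutive: "(p ! i, p ! j) \<in> parcs G" if "i < k" "j < k" "j = Suc i \<or> i = Suc j" for i j
    using that step arcs_symmetric by auto
  show ?thesis
  proof (cases "k \<ge> 3 \<and> (p ! 0, p ! (k - 1)) \<in> parcs G")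
    case True
    have "digraph_iso C (with_proj (cycle_graph k))"
    proof (rule digraph_isoI_list[OF C_parts(1-3) p_dist C_parts(4)])
      fix i j assume "i < length p" "j < length p"
      then have ij: "i < k" "j < k" by (simp_all add: k_def)
      have "(p ! i, p ! j) \<in> parcs G \<longleftrightarrow>
          j = Suc i \<or> i = Suc j \<or> i = 0 \<and> j = k - 1 \<or> i = k - 1 \<and> j = 0"
        (is "?arc \<longleftrightarrow> ?close")
      proof
        assume ?close
        then consider "j = Suc i \<or> i = Suc j" | "i = 0" "j = k - 1" | "i = k - 1" "j = 0" by blast
        then show ?arc
        proof cases
          case 1
          then show ?thesis by (rule consecutive[OF ij])
        qed (use True arcs_symmetric in simp_all)
      qed (rule arc_cases[OF ij])
      also have "\<dots> \<longleftrightarrow> j = Suc i mod k \<or> i = Suc j mod k"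
        using ij by (auto simp: mod_Suc)
      finally show "(p ! i, p ! j) \<in> arcs C \<longleftrightarrow> (i, j) \<in> parcs (cycle_graph k)"
        using ij C_arcs[OF ij] by (simp add: cycle_graph_def)
    qed (auto simp: cycle_graph_def k_def)
    then show ?thesis using True by (auto simp: is_cycle_def)
  next
    case False
    have "digraph_iso C (with_proj (path_graph k))"
    proof (rule digraph_isoI_list[OF C_parts(1-3) p_dist C_parts(4)])
      fix i j assume "i < length p" "j < length p"
      then have ij: "i < k" "j < k" by (simp_all add: k_def)
      have "(p ! i, p ! j) \<in> parcs G \<longleftrightarrow> j = Suc i \<or> i = Suc j"
      proof
        assume arc: "(p ! i, p ! j) \<in> parcs G"
        show "j = Suc i \<or> i = Suc j"
        proof (rule ccontr)
          assume "\<not> ?thesis"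
          then have ends: "i = 0 \<and> j = k - 1 \<or> i = k - 1 \<and> j = 0" using arc_cases[OF ij arc] by blast
          then have "k \<noteq> 2" using \<open>\<not> (j = Suc i \<or> i = Suc j)\<close> by auto
          moreover have "(p ! 0, p ! (k - 1)) \<in> parcs G" using ends arc arcs_symmetric by auto
          ultimately show False using False k by auto
        qed
      qed (rule consecutive[OF ij])
      then show "(p ! i, p ! j) \<in> arcs C \<longleftrightarrow> (i, j) \<in> parcs (path_graph k)"
        using ij C_arcs[OF ij] by (simp add: path_graph_def)
    qed (auto simp: path_graph_def k_def)
    then show ?thesis using k by (auto simp: is_nontrivial_path_def)
  qed
qed

text \<open>
  The components partition the vertices; they also partition the arcs, because the ends of an arc of
  a symmetric graph reach each other.
\<close>

lemma sum_over_components: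
  shows "(\<Sum>C\<in>graph_components G. card (verts C)) = card (pverts G)"
    and "(\<Sum>C\<in>graph_components G. card (arcs C)) = card (parcs G)"
    and "finite (graph_components G)"
proof -
  let ?C = "\<lambda>S. with_proj G \<restriction> S"
  have comps: "graph_components G = ?C ` sccs_verts"
    by (simp add: graph_components_def sccs_conv_sccs_verts)
  have inj: "inj_on ?C sccs_verts" by (rule inj_onI) (metis induce_subgraph_verts)
  have disj: "S \<inter> T = {}" if "S \<in> sccs_verts" "T \<in> sccs_verts" "S \<noteq> T" for S T
    using that by (rule sccs_verts_disjoint)
  have fin: "finite S" if "S \<in> sccs_verts" for S
    using sccs_verts_subsets[OF that] by (rule finite_subset) simp
  show "finite (graph_components G)" unfolding comps using finite_sccs_verts by simp
  have "(\<Sum>S\<in>sccs_verts. card S) = card (\<Union>S\<in>sccs_verts. S)"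
    using finite_sccs_verts fin disj by (intro card_UN_disjoint[symmetric]) auto
  also have "(\<Union>S\<in>sccs_verts. S) = pverts G"
    using sccs_verts_subsets scc_of_in_sccs_verts in_scc_of_self by blast
  finally show "(\<Sum>C\<in>graph_components G. card (verts C)) = card (pverts G)"
    unfolding comps by (subst sum.reindex[OF inj]) simp
  have "(\<Sum>S\<in>sccs_verts. card (arcs (?C S))) = card (\<Union>S\<in>sccs_verts. arcs (?C S))"
  proof (intro card_UN_disjoint[symmetric] ballI impI finite_sccs_verts)
    show "finite (arcs (?C S))" for S
      by (rule finite_subset[OF _ pair_finite_arcs]) auto
    show "arcs (?C S) \<inter> arcs (?C T) = {}" if "S \<in> sccs_verts" "T \<in> sccs_verts" "S \<noteq> T" for S T
      using disj[OF that] by auto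
  qed
  also have "(\<Union>S\<in>sccs_verts. arcs (?C S)) = parcs G"
  proof (intro equalityI subsetI)
    fix a assume a: "a \<in> parcs G"
    then obtain u v where uv: "a = (u, v)" "(u, v) \<in> parcs G" by (cases a) auto
    have "v \<rightarrow>\<^sup>*\<^bsub>with_proj G\<^esub> u" using uv arcs_symmetric by (auto intro: reachable_adjI)
    then have "v \<in> scc_of u" by (rule scc_ofI_reachable)
    then have "a \<in> arcs (?C (scc_of u))" using uv in_arcsD1 in_scc_of_self by auto
    moreover have "scc_of u \<in> sccs_verts" using uv in_arcsD1 scc_of_in_sccs_verts by auto
    ultimately show "a \<in> (\<Union>S\<in>sccs_verts. arcs (?C S))" by blast
  qed auto
  finally show "(\<Sum>C\<in>graph_components G. card (arcs C)) = card (parcs G)"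
    unfolding comps by (subst sum.reindex[OF inj]) simp
qed

text \<open>
  A path has one edge fewer than vertices and a cycle equally many; arcs count every edge twice.
\<close>

lemma card_path_components:
  assumes deg: "\<And>v. v \<in> pverts G \<Longrightarrow> card (parcs G `` {v}) \<in> {1, 2}"
  shows "card (parcs G) + 2 * card {C \<in> graph_components G. is_nontrivial_path C}
    = 2 * card (pverts G)"
proof -
  have "card (arcs C) + (if is_nontrivial_path C then 2 else 0) = 2 * card (verts C)"
    if "C \<in> graph_components G" for C
    using component_cycle_or_path[OF deg that] card_arcs_nontrivial_path card_arcs_cycle by auto
  then have "(\<Sum>C\<in>graph_components G. card (arcs C) + (if is_nontrivial_path C then 2 else 0))
      = (\<Sum>C\<in>graph_components G. 2 * card (verts C))"
    by (intro sum.cong refl)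
  moreover have "(\<Sum>C\<in>graph_components G. if is_nontrivial_path C then 2 else 0)
      = 2 * card {C \<in> graph_components G. is_nontrivial_path C}"
    using sum_over_components(3) by (simp add: sum.If_cases Int_def)
  ultimately show ?thesis
    using sum_over_components(1,2) by (simp add: sum.distrib sum_distrib_left[symmetric])
qed

end

section \<open>Extremal graphs\<close>

lemma (in pair_graph) max_degree_eqI:
  assumes "\<And>v. v \<in> pverts G \<Longrightarrow> card (parcs G `` {v}) \<le> k"
    and "v \<in> pverts G" "card (parcs G `` {v}) = k"
  shows "max_degree G = k"
  unfolding max_degree_def out_degree_eq_card_Image
  using assms by (intro Max_eqI) auto

lemma (in pair_graph) min_degree_eqI:
  assumes "\<And>v. v \<in> pverts G \<Longrightarrow> k \<le> card (parcs G `` {v})"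
    and "v \<in> pverts G" "card (parcs G `` {v}) = k"
  shows "min_degree G = k"
  unfolding min_degree_def out_degree_eq_card_Image
  using assms by (intro Min_eqI) auto

theorem theorem1p2:
  fixes m n s :: nat and G :: "'a pair_pre_digraph"
  assumes "m \<ge> 3"
    and "n = nat \<lceil>(1 + sqrt (8 * real m)) / 2\<rceil>"
    and "s = m - ((n - 1) choose 2)"
    and "G \<in> connected_graphs_with_edges m"
    and "\<And>G' :: nat pair_pre_digraph. G' \<in> connected_graphs_with_edges m \<Longrightarrow>
           distance_spectral_radius G \<le> distance_spectral_radius G'"
  shows "card (pverts G) = n \<and>
    (real s \<ge> (real n - 1) / 2 \<longrightarrow> max_degree G = n - 1) \<and>
    (real s = (real n - 2) / 2 \<and> even n \<longrightarrow> max_degree G = n - 2 \<and> min_degree G = n - 2) \<and>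
    (1 \<le> s \<and> real s < (real n - 2) / 2 \<longrightarrow>
       max_degree G = n - 2 \<and> min_degree G = n - 3 \<and>
       (\<forall>H \<in> graph_components (graph_complement G). is_cycle H \<or> is_nontrivial_path H) \<and>
       card {H \<in> graph_components (graph_complement G). is_nontrivial_path H} = s + 1)"
proof -
  note bounds = ceiling_order_bounds[OF assms(1,2)]
  have pred: "n - 1 - 1 = n - 2" by simp
  have s_eq: "2 * s + (n - 1) * (n - 2) = 2 * m"
    using bounds(1) two_times_choose_two[of "n - 1"] unfolding assms(3) pred by linarith
  have next_order: "n * (n - 1) = (n - 1) * (n - 2) + 2 * (n - 1)"
  proof -
    obtain k where "n = k + 2" using bounds(3) by (intro that[of "n - 2"]) simp
    then show ?thesis by (simp add: algebra_simps)
  qed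
  have s: "1 \<le> s" "s \<le> n - 1" using s_eq bounds(1,2) next_order by linarith+
  have m_eq: "2 * m = (n - 1) * (n - 2) + 2 * s" using s_eq by simp
  have order: "card (pverts G) = n"
    and size: "card (parcs (graph_complement G)) = 2 * (n - 1 - s)"
    and deg_12: "2 * s + 2 \<le> n \<Longrightarrow> v \<in> pverts G \<Longrightarrow>
      card (parcs (graph_complement G) `` {v}) \<in> {1, 2}" for v
    by (rule extremal_order_and_complement_degrees[OF bounds(3) s m_eq assms(4)];
        use assms(5) in blast)+
  interpret pair_graph G using assms(4) by (simp add: connected_graphs_with_edges_def)
  interpret H: pair_graph "graph_complement G" by (rule pair_graph_complement)
  define c where "c v = card (parcs (graph_complement G) `` {v})" for v
  have degree: "card (parcs G `` {v}) = n - 1 - c v" "c v \<le> n - 1" if "v \<in> pverts G" for v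
    using degree_add_complement_degree[OF that] order by (simp_all add: c_def)
  have "real (\<Sum>v\<in>pverts G. c v) = real (card (parcs (graph_complement G)))"
    using card_arcs_eq_sum_degrees[OF H.pair_finite_verts H.parcs_subset] by (simp add: c_def)
  then have sum_c: "(\<Sum>v\<in>pverts G. c v) = 2 * (n - 1 - s)"
    using size by (simp only: of_nat_eq_iff)
  have "max_degree G = n - 1" if "real s \<ge> (real n - 1) / 2"
  proof -
    have "real n - 1 \<le> 2 * real s" using that by simp
    then have "n \<le> 2 * s + 1" by linarith
    \<comment> \<open>The complement has fewer than \<open>n\<close> arcs, so it has an isolated vertex.\<close>
    have "\<exists>v\<in>pverts G. c v = 0"
    proof (rule ccontr)
      assume "\<not> ?thesis"
      then have "(\<Sum>v\<in>pverts G. 1) \<le> (\<Sum>v\<in>pverts G. c v)"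
        by (intro sum_mono) (auto simp: Suc_le_eq)
      then show False using sum_c order \<open>n \<le> 2 * s + 1\<close> bounds(3) by simp
    qed
    then obtain v where "v \<in> pverts G" "c v = 0" by blast
    then show ?thesis using degree by (intro max_degree_eqI[of _ v]) auto
  qed
  moreover have "max_degree G = n - 2 \<and> min_degree G = n - 2" if "real s = (real n - 2) / 2"
  proof -
    have "real n = real (2 * s + 2)" using that by simp
    then have n_eq: "n = 2 * s + 2" by (simp only: of_nat_eq_iff)
    have c12: "c v \<in> {1, 2}" if "v \<in> pverts G" for v
      using deg_12[OF _ that] n_eq by (simp add: c_def)
    \<comment> \<open>The complement degrees are 1 or 2 and average exactly 1.\<close>
    have c1: "c v = 1" if "v \<in> pverts G" for v
    proof (rule ccontr)
      assume "c v \<noteq> 1"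
      then have "1 < c v" using c12[OF that] by auto
      moreover have "1 \<le> c w" if "w \<in> pverts G" for w using c12[OF that] by auto
      ultimately have "(\<Sum>v\<in>pverts G. 1) < (\<Sum>v\<in>pverts G. c v)"
        using that by (intro sum_strict_mono_ex1) auto
      then show False using sum_c order n_eq by simp
    qed
    obtain v where "v \<in> pverts G" using order bounds(3) by fastforce
    then show ?thesis using c1 degree by (auto intro!: max_degree_eqI[of _ v] min_degree_eqI[of _ v])
  qed
  moreover have "max_degree G = n - 2 \<and> min_degree G = n - 3 \<and>
       (\<forall>H \<in> graph_components (graph_complement G). is_cycle H \<or> is_nontrivial_path H) \<and>
       card {H \<in> graph_components (graph_complement G). is_nontrivial_path H} = s + 1"
    if "real s < (real n - 2) / 2"
  proof -
    have "real (2 * s + 2) < real n" using that by simp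
    then have n_gt: "2 * s + 2 < n" by (simp only: of_nat_less_iff)
    have c12: "c v \<in> {1, 2}" if "v \<in> pverts G" for v
      using deg_12[OF _ that] n_gt by (simp add: c_def)
    \<comment> \<open>The complement degrees average strictly between 1 and 2, so both values occur.\<close>
    have "\<exists>v\<in>pverts G. c v = 1"
    proof (rule ccontr)
      assume "\<not> ?thesis"
      then have "(\<Sum>v\<in>pverts G. c v) = (\<Sum>v\<in>pverts G. 2)" using c12 by (intro sum.cong) auto
      then show False using sum_c order s bounds(3) by simp
    qed
    then obtain v where v: "v \<in> pverts G" "c v = 1" by blast
    have "\<exists>w\<in>pverts G. c w = 2"
    proof (rule ccontr)
      assume "\<not> ?thesis"
      then have "(\<Sum>v\<in>pverts G. c v) = (\<Sum>v\<in>pverts G. 1)" using c12 by (intro sum.cong) auto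
      then show False using sum_c order n_gt by simp
    qed
    then obtain w where w: "w \<in> pverts G" "c w = 2" by blast
    have "max_degree G = n - 2"
      using v degree c12 by (intro max_degree_eqI[of _ v]) fastforce+
    moreover have "min_degree G = n - 3"
      using w degree c12 by (intro min_degree_eqI[of _ w]) fastforce+
    moreover have deg: "card (parcs (graph_complement G) `` {v}) \<in> {1, 2}"
      if "v \<in> pverts (graph_complement G)" for v
      using c12[of v] that by (simp add: c_def)
    moreover have "card {H \<in> graph_components (graph_complement G). is_nontrivial_path H} = s + 1"
      using H.card_path_components[OF deg] size order s n_gt by simp
    ultimately show ?thesis using H.component_cycle_or_path[OF deg] by blast
  qed
  ultimately show ?thesis using order by blast
qed

end
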